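(* Let $P,Q$ be orthogonal projections in $(\mathscr{A},\tau)$, let $R=2P-\mathbf 1$, $S=2Q-\mathbf 1$ be the associated symmetries, and let $(U_t)_{t\ge0}$ be a free unitary Brownian motion freely independent from $\{P,Q\}$. Then for any $n\ge1$ and $t\ge 0$, $$\tau[(PU_tQU_t^* )^n]=\frac1{2^{2n+1}}\binom{2n}{n}+\frac{\tau(R+S)}{4}+\frac1{2^{2n}}\sum_{k=1}^n\binom{2n}{n-k}\,\tau[(RU_tSU_t^* )^k].$$
   Context: $(\mathscr{A},\tau)$ is a $W^*$-probability space (von Neumann algebra with faithful normal tracial state $\tau$). $(U_t)_{t\ge0}$, $U_0=\mathbf 1$, solves $dU_t=iU_t\,dB_t-\tfrac12U_t\,dt$ with $(B_t)$ a free additive (semicircular) Brownian motion, $\tau(B_t^2)=t$. *)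

theory Defs
  imports "HOL-Analysis.Analysis"
begin

section \<open>Complex Hilbert spaces and their bounded operators\<close>

class scaleC =
  fixes scaleC :: "complex \<Rightarrow> 'a \<Rightarrow> 'a" (infixr "*\<^sub>C" 75)

text \<open>The inner product is linear in the second argument. The norm and its completeness are those of
  the underlying real inner product space, so positive definiteness is inherited from
  \<^class>\<open>real_inner\<close>.\<close>

class complex_hilbert = scaleC + real_inner + complete_space +
  fixes cinner :: "'a \<Rightarrow> 'a \<Rightarrow> complex"
  assumes scaleC_add_right: "c *\<^sub>C (x + y) = c *\<^sub>C x + c *\<^sub>C y"
    and scaleC_add_left: "(c + d) *\<^sub>C x = c *\<^sub>C x + d *\<^sub>C x"
    and scaleC_scaleC: "c *\<^sub>C d *\<^sub>C x = (c * d) *\<^sub>C x"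
    and scaleC_of_real: "complex_of_real r *\<^sub>C x = r *\<^sub>R x"
    and cinner_commute: "cinner x y = cnj (cinner y x)"
    and cinner_add_right: "cinner x (y + z) = cinner x y + cinner x z"
    and cinner_scaleC_right: "cinner x (c *\<^sub>C y) = c * cinner x y"
    and Re_cinner: "Re (cinner x y) = inner x y"

typedef (overloaded) 'h cop =
  "{T :: 'h::complex_hilbert \<Rightarrow> 'h. bounded_linear T \<and> (\<forall>c x. T (c *\<^sub>C x) = c *\<^sub>C T x)}"
  morphisms cop_apply Cop
proof
  show "(\<lambda>x. x) \<in> {T :: 'h \<Rightarrow> 'h. bounded_linear T \<and> (\<forall>c x. T (c *\<^sub>C x) = c *\<^sub>C T x)}"
    by simp
qed

setup_lifting type_definition_cop

lemma scaleC_scaleR: "c *\<^sub>C r *\<^sub>R x = r *\<^sub>R c *\<^sub>C (x :: 'h::complex_hilbert)"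
  by (simp add: scaleC_of_real [symmetric] scaleC_scaleC mult.commute)

lemma scaleC_zero: "c *\<^sub>C 0 = (0 :: 'h::complex_hilbert)"
  using scaleC_scaleR [of c 0 0] by simp

lemma scaleC_minus: "c *\<^sub>C (- x) = - (c *\<^sub>C (x :: 'h::complex_hilbert))"
  using scaleC_scaleR [of c "-1" x] by simp

lemma scaleC_diff: "c *\<^sub>C (x - y) = c *\<^sub>C x - c *\<^sub>C (y :: 'h::complex_hilbert)"
  using scaleC_add_right [of c x "- y"] by (simp add: scaleC_minus)

lemma norm_scaleC: "norm (c *\<^sub>C x) = cmod c * norm (x :: 'h::complex_hilbert)"
proof -
  have im: "Im (cinner x x) = 0"
    using arg_cong [OF cinner_commute [of x x], of Im] by simp
  have "cinner (c *\<^sub>C x) (c *\<^sub>C x) = cnj c * c * cinner x x"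
    by (metis cinner_commute cinner_scaleC_right complex_cnj_mult mult.assoc mult.left_commute)
  then have "inner (c *\<^sub>C x) (c *\<^sub>C x) = (cmod c)\<^sup>2 * inner x x"
    unfolding Re_cinner [symmetric] cmod_power2 by (simp add: im power2_eq_square)
  then show ?thesis
    by (simp add: norm_eq_sqrt_inner real_sqrt_mult)
qed

lemma bounded_linear_scaleC: "bounded_linear (\<lambda>x :: 'h::complex_hilbert. c *\<^sub>C x)"
  by (rule bounded_linear_intro [where K = "cmod c"])
    (simp_all add: scaleC_add_right scaleC_scaleR norm_scaleC mult.commute)

text \<open>The norm on operators is the operator norm, multiplication is composition.\<close>

instantiation cop :: (complex_hilbert) "{real_normed_algebra, monoid_mult, scaleC}"
begin

lift_definition norm_cop :: "'a cop \<Rightarrow> real" is onorm .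

lift_definition minus_cop :: "'a cop \<Rightarrow> 'a cop \<Rightarrow> 'a cop" is "\<lambda>f g x. f x - g x"
  by (simp add: bounded_linear_sub scaleC_diff)

definition dist_cop :: "'a cop \<Rightarrow> 'a cop \<Rightarrow> real"
  where "dist_cop a b = norm (a - b)"

definition uniformity_cop :: "('a cop \<times> 'a cop) filter"
  where "uniformity_cop = (INF e\<in>{0<..}. principal {(x, y). dist x y < e})"

definition open_cop :: "'a cop set \<Rightarrow> bool"
  where "open_cop S = (\<forall>x\<in>S. \<forall>\<^sub>F (x', y) in uniformity. x' = x \<longrightarrow> y \<in> S)"

lift_definition uminus_cop :: "'a cop \<Rightarrow> 'a cop" is "\<lambda>f x. - f x"
  by (simp add: bounded_linear_minus scaleC_minus)

lift_definition zero_cop :: "'a cop" is "\<lambda>x. 0"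
  by (simp add: scaleC_zero)

lift_definition plus_cop :: "'a cop \<Rightarrow> 'a cop \<Rightarrow> 'a cop" is "\<lambda>f g x. f x + g x"
  by (simp add: bounded_linear_add scaleC_add_right)

lift_definition scaleR_cop :: "real \<Rightarrow> 'a cop \<Rightarrow> 'a cop" is "\<lambda>r f x. r *\<^sub>R f x"
  by (simp add: bounded_linear_const_scaleR scaleC_scaleR)

lift_definition scaleC_cop :: "complex \<Rightarrow> 'a cop \<Rightarrow> 'a cop" is "\<lambda>c f x. c *\<^sub>C f x"
  by (auto intro: bounded_linear_compose [OF bounded_linear_scaleC]
      simp: scaleC_scaleC mult.commute)

lift_definition times_cop :: "'a cop \<Rightarrow> 'a cop \<Rightarrow> 'a cop" is "\<lambda>f g x. f (g x)"
  by (simp add: bounded_linear_compose)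

lift_definition one_cop :: "'a cop" is "\<lambda>x. x"
  by simp

definition sgn_cop :: "'a cop \<Rightarrow> 'a cop"
  where "sgn_cop x = inverse (norm x) *\<^sub>R x"

instance
proof
  fix a b c :: "'a cop" and r s :: real
  show "a + b + c = a + (b + c)" by transfer (simp add: add.assoc)
  show "a + b = b + a" by transfer (simp add: add.commute)
  show "0 + a = a" by transfer simp
  show "- a + a = 0" by transfer simp
  show "a - b = a + - b" by transfer simp
  show "r *\<^sub>R (a + b) = r *\<^sub>R a + r *\<^sub>R b" by transfer (simp add: scaleR_add_right)
  show "(r + s) *\<^sub>R a = r *\<^sub>R a + s *\<^sub>R a" by transfer (simp add: scaleR_add_left)
  show "r *\<^sub>R s *\<^sub>R a = (r * s) *\<^sub>R a" by transfer simp
  show "1 *\<^sub>R a = a" by transfer simp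
  show "dist a b = norm (a - b)" by (rule dist_cop_def)
  show "sgn a = inverse (norm a) *\<^sub>R a" by (rule sgn_cop_def)
  show "uniformity = (INF e\<in>{0<..}. principal {(x :: 'a cop, y). dist x y < e})"
    by (rule uniformity_cop_def)
  show "open S = (\<forall>x\<in>S. \<forall>\<^sub>F (x', y) in uniformity. x' = x \<longrightarrow> y \<in> S)" for S :: "'a cop set"
    by (rule open_cop_def)
  show "norm a = 0 \<longleftrightarrow> a = 0" by transfer (auto simp: onorm_eq_0)
  show "norm (a + b) \<le> norm a + norm b" by transfer (simp add: onorm_triangle)
  show "norm (r *\<^sub>R a) = \<bar>r\<bar> * norm a" by transfer (simp add: onorm_scaleR)
  show "a * b * c = a * (b * c)" by transfer simp
  show "(a + b) * c = a * c + b * c" by transfer simp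
  show "a * (b + c) = a * b + a * c" by transfer (simp add: linear_simps)
  show "r *\<^sub>R a * b = r *\<^sub>R (a * b)" by transfer simp
  show "a * r *\<^sub>R b = r *\<^sub>R (a * b)" by transfer (simp add: linear_simps)
  show "1 * a = a" "a * 1 = a" by (transfer, simp)+
  show "norm (a * b) \<le> norm a * norm b"
    by transfer (auto dest: onorm_compose simp: o_def)
qed

end

definition adj :: "'h::complex_hilbert cop \<Rightarrow> 'h cop" where
  "adj T = (THE S. \<forall>x y. cinner (cop_apply S x) y = cinner x (cop_apply T y))"

definition pos_op :: "'h::complex_hilbert cop \<Rightarrow> bool" where
  "pos_op T \<longleftrightarrow> (\<forall>x. cinner x (cop_apply T x) \<in> \<real>\<^sub>\<ge>\<^sub>0)"

definition orthogonal_projection :: "'h::complex_hilbert cop \<Rightarrow> bool" where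
  "orthogonal_projection P \<longleftrightarrow> P * P = P \<and> adj P = P"

section \<open>\<open>W\<^sup>*\<close>-probability spaces\<close>

definition commutant :: "'h::complex_hilbert cop set \<Rightarrow> 'h cop set" where
  "commutant S = {T. \<forall>A\<in>S. T * A = A * T}"

definition von_neumann_algebra :: "'h::complex_hilbert cop set \<Rightarrow> bool" where
  "von_neumann_algebra M \<longleftrightarrow> adj ` M \<subseteq> M \<and> commutant (commutant M) = M"

definition vN_generated :: "'h::complex_hilbert cop set \<Rightarrow> 'h cop set" where
  "vN_generated S = commutant (commutant (S \<union> adj ` S))"

definition self_adjoint_part :: "'h::complex_hilbert cop set \<Rightarrow> 'h cop set" where
  "self_adjoint_part M = {a \<in> M. adj a = a}"

definition state_on :: "'h::complex_hilbert cop set \<Rightarrow> ('h cop \<Rightarrow> complex) \<Rightarrow> bool" where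
  "state_on M \<tau> \<longleftrightarrow>
     (\<forall>a\<in>M. \<forall>b\<in>M. \<tau> (a + b) = \<tau> a + \<tau> b) \<and>
     (\<forall>c. \<forall>a\<in>M. \<tau> (c *\<^sub>C a) = c * \<tau> a) \<and>
     (\<forall>a\<in>M. \<tau> (adj a * a) \<in> \<real>\<^sub>\<ge>\<^sub>0) \<and>
     \<tau> 1 = 1"

definition faithful_on :: "'h::complex_hilbert cop set \<Rightarrow> ('h cop \<Rightarrow> complex) \<Rightarrow> bool" where
  "faithful_on M \<tau> \<longleftrightarrow> (\<forall>a\<in>M. \<tau> (adj a * a) = 0 \<longrightarrow> a = 0)"

definition tracial_on :: "'h::complex_hilbert cop set \<Rightarrow> ('h cop \<Rightarrow> complex) \<Rightarrow> bool" where
  "tracial_on M \<tau> \<longleftrightarrow> (\<forall>a\<in>M. \<forall>b\<in>M. \<tau> (a * b) = \<tau> (b * a))"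

definition is_supremum_in :: "'h::complex_hilbert cop set \<Rightarrow> 'h cop set \<Rightarrow> 'h cop \<Rightarrow> bool" where
  "is_supremum_in N D s \<longleftrightarrow>
     s \<in> N \<and> (\<forall>d\<in>D. pos_op (s - d)) \<and>
     (\<forall>u\<in>N. (\<forall>d\<in>D. pos_op (u - d)) \<longrightarrow> pos_op (u - s))"

text \<open>Normality: the state preserves suprema of upward directed sets of self-adjoint elements
  (it is real on such elements).\<close>

definition normal_on :: "'h::complex_hilbert cop set \<Rightarrow> ('h cop \<Rightarrow> complex) \<Rightarrow> bool" where
  "normal_on M \<tau> \<longleftrightarrow>
     (\<forall>D s. D \<subseteq> self_adjoint_part M \<and> D \<noteq> {} \<and>
        (\<forall>a\<in>D. \<forall>b\<in>D. \<exists>c\<in>D. pos_op (c - a) \<and> pos_op (c - b)) \<and>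
        is_supremum_in (self_adjoint_part M) D s
        \<longrightarrow> Re (\<tau> s) = (SUP d\<in>D. Re (\<tau> d)))"

definition wstar_probability_space ::
    "'h::complex_hilbert cop set \<Rightarrow> ('h cop \<Rightarrow> complex) \<Rightarrow> bool" where
  "wstar_probability_space M \<tau> \<longleftrightarrow>
     von_neumann_algebra M \<and> state_on M \<tau> \<and> faithful_on M \<tau> \<and> normal_on M \<tau> \<and> tracial_on M \<tau>"

section \<open>Free independence\<close>

inductive_set star_algebra :: "'h::complex_hilbert cop set \<Rightarrow> 'h cop set"
  for S :: "'h cop set" where
    generator: "a \<in> S \<Longrightarrow> a \<in> star_algebra S"
  | one: "1 \<in> star_algebra S"
  | add: "a \<in> star_algebra S \<Longrightarrow> b \<in> star_algebra S \<Longrightarrow> a + b \<in> star_algebra S"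
  | mult: "a \<in> star_algebra S \<Longrightarrow> b \<in> star_algebra S \<Longrightarrow> a * b \<in> star_algebra S"
  | scale: "a \<in> star_algebra S \<Longrightarrow> c *\<^sub>C a \<in> star_algebra S"
  | star: "a \<in> star_algebra S \<Longrightarrow> adj a \<in> star_algebra S"

text \<open>Sets are freely independent if the unital \<open>*\<close>-algebras they generate are: alternating products
  of centred elements are centred. A word is a list of letters tagged with their family index.\<close>

definition free_family ::
    "('h::complex_hilbert cop \<Rightarrow> complex) \<Rightarrow> 'i set \<Rightarrow> ('i \<Rightarrow> 'h cop set) \<Rightarrow> bool" where
  "free_family \<tau> I F \<longleftrightarrow>
     (\<forall>w :: ('i \<times> 'h cop) list. w \<noteq> [] \<and> distinct_adj (map fst w) \<and>
        (\<forall>(i, a)\<in>set w. i \<in> I \<and> a \<in> star_algebra (F i) \<and> \<tau> a = 0)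
        \<longrightarrow> \<tau> (prod_list (map snd w)) = 0)"

definition free_sets ::
    "('h::complex_hilbert cop \<Rightarrow> complex) \<Rightarrow> 'h cop set \<Rightarrow> 'h cop set \<Rightarrow> bool" where
  "free_sets \<tau> S T \<longleftrightarrow> free_family \<tau> (UNIV :: bool set) (\<lambda>b. if b then S else T)"

section \<open>Free additive Brownian motion\<close>

text \<open>The law of a self-adjoint element is determined by its moments. Processes are functions on
  \<^typ>\<open>real\<close>, of which only the values at times \<open>t \<ge> 0\<close> matter.\<close>

definition semicircular ::
    "('h::complex_hilbert cop \<Rightarrow> complex) \<Rightarrow> real \<Rightarrow> 'h cop \<Rightarrow> bool" where
  "semicircular \<tau> v x \<longleftrightarrow> adj x = x \<and>
     (\<forall>k::nat. \<tau> (x ^ k) = complex_of_real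
        (integral {- 2 * sqrt v..2 * sqrt v} (\<lambda>y. y ^ k * (sqrt (4 * v - y\<^sup>2) / (2 * pi * v)))))"

definition filtration :: "(real \<Rightarrow> 'h::complex_hilbert cop) \<Rightarrow> real \<Rightarrow> 'h cop set" where
  "filtration B t = vN_generated (B ` {0..t})"

definition free_brownian_motion ::
    "'h::complex_hilbert cop set \<Rightarrow> ('h cop \<Rightarrow> complex) \<Rightarrow> (real \<Rightarrow> 'h cop) \<Rightarrow> bool" where
  "free_brownian_motion M \<tau> B \<longleftrightarrow>
     B 0 = 0 \<and> (\<forall>t\<ge>0. B t \<in> self_adjoint_part M) \<and>
     (\<forall>s t. 0 \<le> s \<and> s < t \<longrightarrow>
        semicircular \<tau> (t - s) (B t - B s) \<and> free_sets \<tau> {B t - B s} (filtration B s))"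

section \<open>Free stochastic integral and free unitary Brownian motion\<close>

definition norm2 :: "('h::complex_hilbert cop \<Rightarrow> complex) \<Rightarrow> 'h cop \<Rightarrow> real" where
  "norm2 \<tau> x = sqrt (Re (\<tau> (adj x * x)))"

text \<open>A simple adapted process on \<open>[0,t]\<close> takes the value \<open>V j\<close>, measurable at the left endpoint, on
  \<open>[s j, s (Suc j))\<close>, for a partition \<open>0 = s 0 \<le> \<dots> \<le> s m = t\<close>.\<close>

definition adapted_step ::
    "(real \<Rightarrow> 'h::complex_hilbert cop) \<Rightarrow> real \<Rightarrow> nat \<Rightarrow> (nat \<Rightarrow> real) \<Rightarrow> (nat \<Rightarrow> 'h cop) \<Rightarrow> bool" where
  "adapted_step B t m s V \<longleftrightarrow>
     s 0 = 0 \<and> s m = t \<and> (\<forall>j<m. s j \<le> s (Suc j) \<and> V j \<in> filtration B (s j))"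

definition step_process ::
    "nat \<Rightarrow> (nat \<Rightarrow> real) \<Rightarrow> (nat \<Rightarrow> 'h::complex_hilbert cop) \<Rightarrow> real \<Rightarrow> 'h cop" where
  "step_process m s V r = (\<Sum>j<m. indicat_real {s j..<s (Suc j)} r *\<^sub>R V j)"

definition step_integral ::
    "(real \<Rightarrow> 'h::complex_hilbert cop) \<Rightarrow> nat \<Rightarrow> (nat \<Rightarrow> real) \<Rightarrow> (nat \<Rightarrow> 'h cop) \<Rightarrow> 'h cop" where
  "step_integral B m s V = (\<Sum>j<m. V j * (B (s (Suc j)) - B (s j)))"

text \<open>\<open>Y\<close> is the free It\^o integral of \<open>X\<close> against \<open>dB\<close> (on the right) over \<open>[0,t]\<close>: the extension
  of the integral of simple adapted processes by the \<open>L\<^sup>2\<close> isometry.\<close>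

definition has_free_ito_integral ::
    "'h::complex_hilbert cop set \<Rightarrow> ('h cop \<Rightarrow> complex) \<Rightarrow> (real \<Rightarrow> 'h cop) \<Rightarrow> (real \<Rightarrow> 'h cop) \<Rightarrow>
      real \<Rightarrow> 'h cop \<Rightarrow> bool" where
  "has_free_ito_integral M \<tau> B X t Y \<longleftrightarrow> Y \<in> M \<and>
     (\<exists>m s V e.
        (\<forall>k::nat. adapted_step B t (m k) (s k) (V k)) \<and>
        (\<forall>k. ((\<lambda>r. (norm2 \<tau> (X r - step_process (m k) (s k) (V k) r))\<^sup>2) has_integral e k) {0..t}) \<and>
        e \<longlonglongrightarrow> 0 \<and>
        (\<lambda>k. norm2 \<tau> (Y - step_integral B (m k) (s k) (V k))) \<longlonglongrightarrow> 0)"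

text \<open>A solution of \<open>dU\<^sub>t = i U\<^sub>t dB\<^sub>t - (1/2) U\<^sub>t dt\<close>, \<open>U\<^sub>0 = 1\<close>, is a norm continuous adapted
  process satisfying the integrated equation; unitarity of \<open>U\<^sub>t\<close> is a consequence and not
  imposed.\<close>

definition solves_unitary_sde ::
    "'h::complex_hilbert cop set \<Rightarrow> ('h cop \<Rightarrow> complex) \<Rightarrow> (real \<Rightarrow> 'h cop) \<Rightarrow> (real \<Rightarrow> 'h cop) \<Rightarrow> bool"
    where
  "solves_unitary_sde M \<tau> B U \<longleftrightarrow>
     U 0 = 1 \<and> continuous_on {0..} U \<and> (\<forall>t\<ge>0. U t \<in> filtration B t) \<and>
     (\<forall>t\<ge>0. \<exists>Y D. has_free_ito_integral M \<tau> B U t Y \<and> (U has_integral D) {0..t} \<and>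
        U t = 1 + \<i> *\<^sub>C Y - (1 / 2) *\<^sub>R D)"

definition free_unitary_brownian_motion ::
    "'h::complex_hilbert cop set \<Rightarrow> ('h cop \<Rightarrow> complex) \<Rightarrow> (real \<Rightarrow> 'h cop) \<Rightarrow> bool" where
  "free_unitary_brownian_motion M \<tau> U \<longleftrightarrow>
     (\<exists>B. free_brownian_motion M \<tau> B \<and> solves_unitary_sde M \<tau> B U)"

end

theory Submission
  imports Defs
begin

text \<open>Once \<open>U\<^sub>t\<close> is known to be unitary, \<open>P\<close> and \<open>U\<^sub>t Q U\<^sub>t*\<close> are two projections in a
  tracial algebra, and the formula holds for any such pair. For symmetries \<open>R\<close>, \<open>S\<close> and the unitary
  \<open>W = R S\<close> one has \<open>R W R = W\<^sup>-\<^sup>1\<close>, so that \<open>P Q P\<close> is \<open>P\<close> times the element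
  \<open>X = (1 + W)\<^sup>2 W\<^sup>-\<^sup>1 / 4\<close> commuting with \<open>P\<close>, and the trace of \<open>P X\<^sup>n\<close> is read off the
  binomial theorem.

  Unitarity comes from stochastic calculus for \<open>w = U U* - 1\<close>. Over a short interval of length \<open>h\<close>,
  \<open>U\<close> changes by \<open>i U dB\<close> up to an \<open>L\<^sup>2\<close> error \<open>o(\<surd>h)\<close>; the martingale parts in the
  increment of \<open>w\<close> cancel, as do its drift and the second order term, so \<open>\<tau> (w\<^sup>2)\<close> has derivative
  \<open>0\<close> and vanishes. In a finite von Neumann algebra \<open>U U* = 1\<close> implies \<open>U* U = 1\<close>.\<close>

section \<open>Adjoints and completeness\<close>

text \<open>The choice of \<open>w = U U* - 1\<close> rather than \<open>U* U - 1\<close> is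
  dictated by the noise standing to the right of \<open>U\<close>: with \<open>X\<close> an
  increment of \<open>B\<close>, the first order terms \<open>i U X U*\<close> and
  \<open>- i U X U*\<close> of \<open>w\<close> cancel, while \<open>U* U\<close> would leave a
  commutator of \<open>U* U\<close> with \<open>X\<close>. The equation is used in integrated form
  on short intervals of length \<open>h\<close>. The stochastic integral is only an
  \<open>L\<^sup>2\<close> limit, and its approximation by \<open>U dB\<close> has error o(sqrt h),
  too coarse for terms of order \<open>h\<close>. First order terms are therefore handled by exact
  orthogonality of the integral to the past, second order ones by the approximation. A product of
  two elements small in \<open>L\<^sup>2\<close> need not be small in \<open>L\<^sup>2\<close>, so
  one factor is always bounded in operator norm; hence the norm continuity of \<open>U\<close> and
  the inequality \<open>n2 (a * b) \<le> norm a * n2 b\<close>. The latter rests on a square root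
  inside the algebra, for which the space of operators must be complete.\<close>

lemma Riesz_representation_real:
  fixes f :: "'a::{real_inner,complete_space} \<Rightarrow> real"
  assumes f: "bounded_linear f"
  obtains z where "\<And>x. inner z x = f x"
proof -
  interpret f: bounded_linear f by (rule f)
  obtain K where K: "\<And>x. norm (f x) \<le> norm x * K" "K > 0"
    using f.pos_bounded by auto
  \<comment> \<open>For the vector \<open>z\<close> sought, \<open>J x\<close> is
    \<open>(norm (x - z))\<^sup>2 - (norm z)\<^sup>2\<close>, so \<open>z\<close> is found as a
    minimiser.\<close>
  define J where "J x = (norm x)\<^sup>2 - 2 * f x" for x
  have J_lower: "J x \<ge> - K\<^sup>2" for x
  proof -
    have "f x \<le> norm x * K" using K(1) [of x] by simp
    moreover have "0 \<le> (norm x - K)\<^sup>2" by simp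
    ultimately show ?thesis by (simp add: J_def power2_diff)
  qed
  have bdd: "bdd_below (range J)" using J_lower by (rule bdd_belowI2)
  define m where "m = (INF x. J x)"
  have m_le: "m \<le> J x" for x
    unfolding m_def by (rule cINF_lower [OF bdd]) simp
  have "\<exists>x. J x < m + 1 / real (Suc n)" for n
    using cINF_less_iff [OF _ bdd, of "m + 1 / real (Suc n)"] by (auto simp: m_def)
  then obtain X where X: "\<And>n. J (X n) < m + 1 / real (Suc n)" by metis
  \<comment> \<open>The parallelogram law, with the lower bound \<open>m\<close> at the midpoint,
    makes a minimising sequence Cauchy.\<close>
  have par: "(norm (x - y))\<^sup>2 \<le> 2 * (J x + J y - 2 * m)" for x y
  proof -
    have "4 * (norm ((1/2) *\<^sub>R (x + y)))\<^sup>2 + (norm (x - y))\<^sup>2 = 2 * (norm x)\<^sup>2 + 2 * (norm y)\<^sup>2"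
      by (simp add: power2_norm_eq_inner algebra_simps inner_commute)
    moreover have "4 * f ((1/2) *\<^sub>R (x + y)) = 2 * f x + 2 * f y"
      by (simp add: f.scaleR f.add)
    ultimately have "4 * J ((1/2) *\<^sub>R (x + y)) + (norm (x - y))\<^sup>2 = 2 * (J x + J y)"
      by (simp add: J_def)
    with m_le [of "(1/2) *\<^sub>R (x + y)"] show ?thesis by simp
  qed
  have "Cauchy X"
  proof (rule metric_CauchyI)
    fix e :: real assume e: "e > 0"
    obtain N where "1 / real (Suc N) < e\<^sup>2 / 4"
      using e reals_Archimedean [of "e\<^sup>2 / 4"] by (auto simp: inverse_eq_divide)
    then have N: "4 / real (Suc N) < e\<^sup>2" by simp
    have "dist (X k) (X l) < e" if "k \<ge> N" "l \<ge> N" for k l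
    proof -
      have "1 / real (Suc k) \<le> 1 / real (Suc N)" "1 / real (Suc l) \<le> 1 / real (Suc N)"
        using that by (simp_all add: frac_le)
      then have "(norm (X k - X l))\<^sup>2 < 2 * (2 / real (Suc N))"
        using par [of "X k" "X l"] X [of k] X [of l] by simp
      also have "\<dots> < e\<^sup>2" using N by simp
      finally show ?thesis using e by (simp add: dist_norm power_less_imp_less_base)
    qed
    then show "\<exists>N. \<forall>k\<ge>N. \<forall>l\<ge>N. dist (X k) (X l) < e" by blast
  qed
  then obtain z where z: "X \<longlonglongrightarrow> z"
    using Cauchy_convergent convergentD by blast
  have "(\<lambda>n. J (X n)) \<longlonglongrightarrow> J z"
    unfolding J_def by (intro tendsto_intros z f.tendsto)
  moreover have "(\<lambda>n. m + 1 / real (Suc n)) \<longlonglongrightarrow> m + 0"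
    by (intro tendsto_intros LIMSEQ_Suc [OF lim_1_over_n])
  ultimately have "J z \<le> m"
    using X by (intro LIMSEQ_le) (auto intro: less_imp_le)
  have "inner z v = f v" for v
  proof -
    define c where "c = inner z v - f v"
    have quad: "t\<^sup>2 * (norm v)\<^sup>2 + 2 * t * c \<ge> 0" for t
    proof -
      have "J (z + t *\<^sub>R v) = J z + t\<^sup>2 * (norm v)\<^sup>2 + 2 * t * c"
        by (simp add: J_def c_def f.add f.scaleR power2_norm_eq_inner)
          (simp add: inner_commute algebra_simps power2_eq_square)
      with m_le [of "z + t *\<^sub>R v"] \<open>J z \<le> m\<close> show ?thesis by simp
    qed
    \<comment> \<open>The optimal \<open>t\<close> is \<open>- c / (norm v)\<^sup>2\<close>; the
      added 1 avoids dividing by zero and still forces \<open>c = 0\<close>.\<close>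
    define d where "d = (norm v)\<^sup>2 + 1"
    have "d > 0" by (simp add: d_def add_nonneg_pos)
    have "(c / d)\<^sup>2 * (norm v)\<^sup>2 - 2 * (c / d) * c \<ge> 0"
      using quad [of "- (c / d)"] by simp
    also have "(c / d)\<^sup>2 * (norm v)\<^sup>2 - 2 * (c / d) * c = (c / d)\<^sup>2 * (- (norm v)\<^sup>2 - 2)"
      using \<open>d > 0\<close> by (simp add: field_simps power2_eq_square) (simp add: d_def power2_eq_square algebra_simps)
    finally have "(c / d)\<^sup>2 * (- (norm v)\<^sup>2 - 2) \<ge> 0" .
    moreover have "- (norm v)\<^sup>2 - 2 < 0"
      by (smt (verit) zero_le_power2)
    ultimately have "(c / d)\<^sup>2 \<le> 0" by (simp add: zero_le_mult_iff)
    then show ?thesis using \<open>d > 0\<close> by (simp add: c_def)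
  qed
  then show ?thesis by (rule that)
qed

section \<open>The complex inner product and adjoints\<close>

lemma cinner_add_left: "cinner (x + y) z = cinner x z + cinner (y :: 'h::complex_hilbert) z"
  by (metis cinner_add_right cinner_commute complex_cnj_add)

lemma cinner_scaleC_left: "cinner (c *\<^sub>C x) y = cnj c * cinner (x :: 'h::complex_hilbert) y"
  by (metis cinner_commute cinner_scaleC_right complex_cnj_mult)

lemma Im_cinner: "Im (cinner x y) = inner x ((- \<i>) *\<^sub>C (y :: 'h::complex_hilbert))"
  by (simp add: Re_cinner [symmetric] cinner_scaleC_right)

lemma cinner_eqI:
  assumes "\<And>z. cinner x z = cinner y (z :: 'h::complex_hilbert)"
  shows "x = y"
proof -
  have "inner (x - y) (x - y) = 0"
    unfolding inner_diff_left using assms [of "x - y"] by (simp flip: Re_cinner)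
  then show ?thesis by simp
qed

lemma bounded_linear_cop_apply: "bounded_linear (cop_apply T)"
  using cop_apply [of T] by simp

lemma cop_apply_scaleC: "cop_apply T (c *\<^sub>C x) = c *\<^sub>C cop_apply T x"
  using cop_apply [of T] by simp

lemma cop_eqI: "(\<And>x. cop_apply S x = cop_apply T x) \<Longrightarrow> S = T"
  by (metis cop_apply_inject ext)

lemma norm_cop_apply_le: "norm (cop_apply T x) \<le> norm T * norm x"
  unfolding norm_cop.rep_eq by (rule onorm [OF bounded_linear_cop_apply])

lemma norm_cop_leI:
  assumes "0 \<le> K" "\<And>x. norm (cop_apply T x) \<le> K * norm x"
  shows "norm T \<le> K"
  unfolding norm_cop.rep_eq using assms by (rule onorm_bound)

lemmas cop_apply_simps = plus_cop.rep_eq minus_cop.rep_eq uminus_cop.rep_eq zero_cop.rep_eq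
  scaleR_cop.rep_eq scaleC_cop.rep_eq times_cop.rep_eq one_cop.rep_eq

text \<open>Riesz representation over the reals yields a real adjoint. It is the complex one because
  the imaginary part of \<open>cinner x y\<close> is a real inner product with
  \<open>(- \<i>) *\<^sub>C y\<close>, and \<open>T\<close> commutes with complex scalars.\<close>

lemma adj_exists: "\<exists>S. \<forall>x y. cinner (cop_apply S x) y = cinner x (cop_apply T y)"
proof -
  have "\<exists>z. \<forall>y. inner z y = inner x (cop_apply T y)" for x
    using Riesz_representation_real [of "\<lambda>y. inner x (cop_apply T y)"]
      bounded_linear_compose [OF bounded_linear_inner_right bounded_linear_cop_apply]
    by metis
  then obtain S where S: "\<And>x y. inner (S x) y = inner x (cop_apply T y)" by metis
  have cS: "cinner (S x) y = cinner x (cop_apply T y)" for x y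
    by (rule complex_eqI) (simp_all only: Im_cinner Re_cinner S cop_apply_scaleC)
  have add: "S (x + y) = S x + S y" for x y
    by (rule cinner_eqI) (simp add: cS cinner_add_left)
  have scC: "S (c *\<^sub>C x) = c *\<^sub>C S x" for c x
    by (rule cinner_eqI) (simp add: cS cinner_scaleC_left)
  have bound: "norm (S x) \<le> norm x * norm T" for x
  proof (cases "S x = 0")
    case False
    have "norm (S x) * norm (S x) = inner x (cop_apply T (S x))"
      by (simp flip: S add: dot_square_norm power2_eq_square)
    also have "\<dots> \<le> norm x * norm (cop_apply T (S x))" by (rule norm_cauchy_schwarz)
    also have "\<dots> \<le> norm x * (norm T * norm (S x))"
      by (intro mult_left_mono norm_cop_apply_le) simp
    finally show ?thesis using False by simp
  qed simp
  have "bounded_linear S"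
    by (rule bounded_linear_intro [OF add _ bound]) (metis scC scaleC_of_real)
  then have "cop_apply (Cop S) = S" using scC by (simp add: Cop_inverse)
  with cS show ?thesis by metis
qed

text \<open>Resolves the definite description in \<open>adj\<close>; all later facts about adjoints
  come from this rule.\<close>

lemma cinner_adj_left: "cinner (cop_apply (adj T) x) y = cinner x (cop_apply T y)"
proof -
  have "\<exists>!S. \<forall>x y. cinner (cop_apply S x) y = cinner x (cop_apply T y)"
    by (rule ex_ex1I [OF adj_exists]) (rule cop_eqI, rule cinner_eqI, simp)
  from theI' [OF this] show ?thesis unfolding adj_def by blast
qed

lemma adj_eqI: "(\<And>x y. cinner (cop_apply S x) y = cinner x (cop_apply T y)) \<Longrightarrow> adj T = S"
  by (rule cop_eqI, rule cinner_eqI) (simp add: cinner_adj_left)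

lemma cinner_adj_right: "cinner x (cop_apply (adj T) y) = cinner (cop_apply T x) y"
  by (metis cinner_adj_left cinner_commute)

lemma adj_adj [simp]: "adj (adj T) = T"
  by (rule adj_eqI) (simp add: cinner_adj_right)

lemma adj_mult: "adj (S * T) = adj T * adj S"
  by (rule adj_eqI) (simp add: cinner_adj_left cop_apply_simps)

lemma adj_add: "adj (S + T) = adj S + adj T"
  by (rule adj_eqI) (simp add: cinner_adj_left cop_apply_simps cinner_add_left cinner_add_right)

lemma adj_scaleC: "adj (c *\<^sub>C T) = cnj c *\<^sub>C adj T"
  by (rule adj_eqI) (simp add: cinner_adj_left cop_apply_simps cinner_scaleC_left cinner_scaleC_right)

lemma scaleR_cop_eq_scaleC: "r *\<^sub>R T = complex_of_real r *\<^sub>C (T :: 'h::complex_hilbert cop)"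
  by (rule cop_eqI) (simp add: cop_apply_simps scaleC_of_real)

lemma adj_scaleR: "adj (r *\<^sub>R T) = r *\<^sub>R adj T"
  by (simp add: scaleR_cop_eq_scaleC adj_scaleC)

lemma adj_minus: "adj (- T) = - adj T"
  using adj_scaleR [of "-1" T] by simp

lemma adj_diff: "adj (S - T) = adj S - adj T"
  using adj_add [of S "- T"] by (simp add: adj_minus)

lemma adj_one [simp]: "adj 1 = 1"
  by (rule adj_eqI) (simp add: cop_apply_simps)

lemma adj_zero [simp]: "adj 0 = 0"
  using adj_scaleR [of 0 0] by simp

lemma adj_power: "adj (T ^ n) = adj T ^ n"
  by (induction n) (simp_all add: adj_mult power_commutes)

lemma norm_adj_le: "norm (adj T) \<le> norm T"
proof (rule norm_cop_leI [OF norm_ge_zero])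
  fix x
  show "norm (cop_apply (adj T) x) \<le> norm T * norm x"
  proof (cases "cop_apply (adj T) x = 0")
    case False
    let ?y = "cop_apply (adj T) x"
    have "norm ?y * norm ?y = Re (cinner ?y ?y)"
      by (simp add: Re_cinner dot_square_norm power2_eq_square)
    also have "\<dots> = inner x (cop_apply T ?y)" by (simp add: cinner_adj_left Re_cinner)
    also have "\<dots> \<le> norm x * norm (cop_apply T ?y)" by (rule norm_cauchy_schwarz)
    also have "\<dots> \<le> norm x * (norm T * norm ?y)"
      by (intro mult_left_mono norm_cop_apply_le) simp
    finally show ?thesis using False by (simp add: mult.commute)
  qed simp
qed

lemma norm_adj [simp]: "norm (adj T) = norm T"
  using norm_adj_le [of T] norm_adj_le [of "adj T"] by simp

lemma bounded_linear_adj: "bounded_linear (adj :: 'h::complex_hilbert cop \<Rightarrow> _)"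
  by (rule bounded_linear_intro [where K = 1]) (simp_all add: adj_add adj_scaleR)

lemma scaleC_cop_mult_left: "(c *\<^sub>C S) * T = c *\<^sub>C (S * (T :: 'h::complex_hilbert cop))"
  by (rule cop_eqI) (simp add: cop_apply_simps)

lemma scaleC_cop_mult_right: "S * (c *\<^sub>C T) = c *\<^sub>C (S * (T :: 'h::complex_hilbert cop))"
  by (rule cop_eqI) (simp add: cop_apply_simps cop_apply_scaleC)

instance complex_hilbert \<subseteq> banach ..

instance cop :: (complex_hilbert) banach
proof
  fix X :: "nat \<Rightarrow> 'a cop"
  assume X: "Cauchy X"
  \<comment> \<open>Operators embed isometrically into the complete space of bounded real linear
    maps; complex linearity of the limit is inherited pointwise.\<close>
  let ?B = "\<lambda>T :: 'a cop. Blinfun (cop_apply T)"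
  have B: "blinfun_apply (?B T) = cop_apply T" for T :: "'a cop"
    by (rule bounded_linear_Blinfun_apply [OF bounded_linear_cop_apply])
  have "norm (?B S - ?B T) = norm (S - T)" for S T :: "'a cop"
    by (simp add: norm_blinfun.rep_eq norm_cop.rep_eq minus_blinfun.rep_eq minus_cop.rep_eq B)
  then have "Cauchy (\<lambda>n. ?B (X n))"
    using X by (simp add: Cauchy_def dist_norm)
  then obtain L where L: "(\<lambda>n. ?B (X n)) \<longlonglongrightarrow> L"
    using Cauchy_convergent convergentD by blast
  have pt: "(\<lambda>n. cop_apply (X n) x) \<longlonglongrightarrow> L x" for x
    using blinfun.tendsto [OF L tendsto_const [of x]] by (simp add: B)
  have "L (c *\<^sub>C x) = c *\<^sub>C L x" for c x
  proof (rule LIMSEQ_unique [OF pt])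
    show "(\<lambda>n. cop_apply (X n) (c *\<^sub>C x)) \<longlonglongrightarrow> c *\<^sub>C L x"
      unfolding cop_apply_scaleC by (rule bounded_linear.tendsto [OF bounded_linear_scaleC pt])
  qed
  then have A: "cop_apply (Cop (blinfun_apply L)) = blinfun_apply L"
    by (simp add: Cop_inverse blinfun.bounded_linear_right)
  have "norm (X n - Cop (blinfun_apply L)) = norm (?B (X n) - L)" for n
    by (simp add: norm_blinfun.rep_eq norm_cop.rep_eq minus_blinfun.rep_eq minus_cop.rep_eq B A)
  then have "X \<longlonglongrightarrow> Cop (blinfun_apply L)"
    using L by (simp add: tendsto_iff dist_norm)
  then show "convergent X" by (auto simp: convergent_def)
qed

section \<open>Square roots and von Neumann algebras\<close>

text \<open>The binomial series with exponent 1/2. In its Cauchy square, Vandermonde's identity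
  turns the coefficients into \<open>1 gchoose k\<close>, which vanish for
  \<open>k \<ge> 2\<close>.\<close>

lemma sqrt_one_minus_series:
  fixes x :: "'a::{real_normed_algebra,monoid_mult,banach}"
  assumes "norm x < 1"
  defines "c \<equiv> \<lambda>k. ((1/2 :: real) gchoose k) *\<^sub>R ((- 1) ^ k *\<^sub>R x ^ k)"
  shows "summable (\<lambda>k. norm (c k))" and "suminf c * suminf c = 1 - x"
proof -
  \<comment> \<open>The type classes do not fix \<open>norm 1 = 1\<close>, and over the zero Hilbert
    space it is 0; hence the extra factor.\<close>
  have norm_pow: "norm (x ^ k) \<le> norm x ^ k * norm (1 :: 'a)" for k
  proof (induction k)
    case (Suc k)
    have "norm (x ^ Suc k) \<le> norm x * norm (x ^ k)" by (simp add: norm_mult_ineq)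
    also have "\<dots> \<le> norm x * (norm x ^ k * norm (1 :: 'a))"
      by (intro mult_left_mono Suc) simp
    finally show ?case by (simp add: mult.assoc)
  qed simp
  have "summable (\<lambda>k. norm (((1/2 :: real) gchoose k) * norm x ^ k))"
  proof (rule abs_summable_in_conv_radius)
    show "ereal (norm (norm x)) < conv_radius (\<lambda>k. (1/2 :: real) gchoose k)"
      using assms(1) by (simp add: conv_radius_gchoose one_ereal_def)
  qed
  then have "summable (\<lambda>k. norm (((1/2 :: real) gchoose k) * norm x ^ k) * norm (1 :: 'a))"
    by (rule summable_mult2)
  then show sum: "summable (\<lambda>k. norm (c k))"
  proof (rule summable_comparison_test')
    show "norm (norm (c k)) \<le> norm (((1/2 :: real) gchoose k) * norm x ^ k) * norm (1 :: 'a)" for k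
      using mult_left_mono [OF norm_pow [of k], of "\<bar>(1/2 :: real) gchoose k\<bar>"]
      by (simp add: c_def abs_mult power_abs mult.assoc)
  qed
  have "(\<lambda>k. \<Sum>i\<le>k. c i * c (k - i)) sums (suminf c * suminf c)"
    by (rule Cauchy_product_sums [OF sum sum])
  moreover have "(\<Sum>i\<le>k. c i * c (k - i)) = ((1::real) gchoose k) *\<^sub>R ((- 1) ^ k *\<^sub>R x ^ k)" for k
  proof -
    have "c i * c (k - i) = (((1/2 :: real) gchoose i) * ((1/2) gchoose (k - i))) *\<^sub>R ((- 1) ^ k *\<^sub>R x ^ k)"
      if "i \<le> k" for i
      using that by (simp add: c_def flip: power_add)
    then have "(\<Sum>i\<le>k. c i * c (k - i)) =
        (\<Sum>i\<le>k. ((1/2 :: real) gchoose i) * ((1/2) gchoose (k - i))) *\<^sub>R ((- 1) ^ k *\<^sub>R x ^ k)"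
      unfolding scaleR_sum_left by (intro sum.cong) auto
    also have "(\<Sum>i\<le>k. ((1/2 :: real) gchoose i) * ((1/2) gchoose (k - i))) = 1 gchoose k"
      using gbinomial_Vandermonde [of "1/2::real" "1/2" k] by (simp add: atMost_atLeast0)
    finally show ?thesis .
  qed
  moreover have "(\<lambda>k. ((1::real) gchoose k) *\<^sub>R ((- 1) ^ k *\<^sub>R x ^ k)) sums
      (\<Sum>k\<in>{0, 1}. ((1::real) gchoose k) *\<^sub>R ((- 1) ^ k *\<^sub>R x ^ k))"
  proof (rule sums_finite)
    fix k :: nat assume "k \<notin> {0, 1}"
    then have "((1::real) gchoose k) = 0"
      using binomial_gbinomial [of 1 k, where 'a = real] by (simp add: binomial_eq_0)
    then show "((1::real) gchoose k) *\<^sub>R ((- 1) ^ k *\<^sub>R x ^ k) = 0" by simp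
  qed simp
  ultimately show "suminf c * suminf c = 1 - x"
    by (simp add: sums_unique2)
qed

section \<open>Commutants and generated von Neumann algebras\<close>

lemma commutant_antimono: "S \<subseteq> T \<Longrightarrow> commutant T \<subseteq> commutant S"
  by (auto simp: commutant_def)

lemma subset_double_commutant: "S \<subseteq> commutant (commutant S)"
  by (auto simp: commutant_def)

locale unital_star_subalgebra =
  fixes A :: "'h::complex_hilbert cop set"
  assumes one_mem: "1 \<in> A"
    and add_mem: "\<And>a b. a \<in> A \<Longrightarrow> b \<in> A \<Longrightarrow> a + b \<in> A"
    and mult_mem: "\<And>a b. a \<in> A \<Longrightarrow> b \<in> A \<Longrightarrow> a * b \<in> A"
    and scaleC_mem: "\<And>a c. a \<in> A \<Longrightarrow> c *\<^sub>C a \<in> A"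
    and adj_mem: "\<And>a. a \<in> A \<Longrightarrow> adj a \<in> A"
begin

lemma scaleR_mem: "a \<in> A \<Longrightarrow> r *\<^sub>R a \<in> A"
  by (simp add: scaleR_cop_eq_scaleC scaleC_mem)

lemma zero_mem: "0 \<in> A"
  using scaleR_mem [OF one_mem, of 0] by simp

lemma minus_mem: "a \<in> A \<Longrightarrow> - a \<in> A"
  using scaleR_mem [of a "-1"] by simp

lemma diff_mem: "a \<in> A \<Longrightarrow> b \<in> A \<Longrightarrow> a - b \<in> A"
  using add_mem [of a "- b"] minus_mem [of b] by simp

lemma power_mem: "a \<in> A \<Longrightarrow> a ^ n \<in> A"
  by (induction n) (simp_all add: one_mem mult_mem)

lemma sum_mem: "(\<And>i. i \<in> I \<Longrightarrow> f i \<in> A) \<Longrightarrow> sum f I \<in> A"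
  by (induction I rule: infinite_finite_induct) (simp_all add: zero_mem add_mem)

lemmas mem = one_mem add_mem mult_mem scaleC_mem adj_mem scaleR_mem zero_mem minus_mem diff_mem
  power_mem

end

lemma unital_star_subalgebra_commutant:
  assumes "adj ` S \<subseteq> S"
  shows "unital_star_subalgebra (commutant S)"
proof
  fix a b :: "'a cop" and c
  assume a: "a \<in> commutant S"
  show "c *\<^sub>C a \<in> commutant S"
    using a by (auto simp: commutant_def scaleC_cop_mult_left scaleC_cop_mult_right)
  show "adj a \<in> commutant S"
    unfolding commutant_def
  proof clarify
    fix s assume "s \<in> S"
    then have "a * adj s = adj s * a" using a assms by (auto simp: commutant_def)
    then have "adj (a * adj s) = adj (adj s * a)" by simp
    then show "adj a * s = s * adj a" by (simp add: adj_mult)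
  qed
  assume b: "b \<in> commutant S"
  show "a + b \<in> commutant S"
    using a b by (auto simp: commutant_def distrib_left distrib_right)
  show "a * b \<in> commutant S"
    using a b by (auto simp: commutant_def) (metis mult.assoc)
qed (simp add: commutant_def)

text \<open>Norm closedness is what keeps the limit of the square root series inside the
  algebra.\<close>

lemma closed_commutant: "closed (commutant S)"
proof -
  have "commutant S = (\<Inter>s\<in>S. {a. a * s = s * a})" by (auto simp: commutant_def)
  moreover have "closed {a. a * s = s * a}" for s :: "'a cop"
    by (intro closed_Collect_eq continuous_intros)
  ultimately show ?thesis by auto
qed

lemma adj_image_commutant:
  assumes "adj ` S \<subseteq> S"
  shows "adj ` commutant S \<subseteq> commutant S"
  using unital_star_subalgebra.adj_mem [OF unital_star_subalgebra_commutant [OF assms]] by auto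

lemma unital_star_subalgebra_double_commutant:
  assumes "adj ` S \<subseteq> S"
  shows "unital_star_subalgebra (commutant (commutant S))"
  by (intro unital_star_subalgebra_commutant adj_image_commutant assms)

lemma unital_star_subalgebra_vN_generated: "unital_star_subalgebra (vN_generated S)"
  unfolding vN_generated_def by (rule unital_star_subalgebra_double_commutant) (auto simp: image_Un image_image)

lemma subset_vN_generated: "S \<subseteq> vN_generated S"
  unfolding vN_generated_def using subset_double_commutant [of "S \<union> adj ` S"] by auto

lemma vN_generated_mono: "S \<subseteq> T \<Longrightarrow> vN_generated S \<subseteq> vN_generated T"
  unfolding vN_generated_def by (intro commutant_antimono Un_mono image_mono)

lemma vN_generated_least:
  assumes "von_neumann_algebra M" "S \<subseteq> M"
  shows "vN_generated S \<subseteq> M"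
proof -
  have "S \<union> adj ` S \<subseteq> M" using assms by (auto simp: von_neumann_algebra_def)
  then have "vN_generated S \<subseteq> commutant (commutant M)"
    unfolding vN_generated_def by (intro commutant_antimono)
  then show ?thesis using assms(1) by (simp add: von_neumann_algebra_def)
qed

section \<open>Tracial states\<close>

locale wstar_space =
  fixes M :: "'h::complex_hilbert cop set" and \<tau> :: "'h cop \<Rightarrow> complex"
  assumes wstar: "wstar_probability_space M \<tau>"
begin

lemma von_neumann: "von_neumann_algebra M"
  and state: "state_on M \<tau>" and faithful: "faithful_on M \<tau>" and tracial: "tracial_on M \<tau>"
  using wstar by (auto simp: wstar_probability_space_def)

sublocale unital_star_subalgebra M
  using unital_star_subalgebra_double_commutant [of M] von_neumann
  by (auto simp: von_neumann_algebra_def)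

declare mem [simp]

lemma closed_M: "closed M"
  using closed_commutant [of "commutant M"] von_neumann by (auto simp: von_neumann_algebra_def)

lemma tau_add: "a \<in> M \<Longrightarrow> b \<in> M \<Longrightarrow> \<tau> (a + b) = \<tau> a + \<tau> b"
  and tau_scaleC: "a \<in> M \<Longrightarrow> \<tau> (c *\<^sub>C a) = c * \<tau> a"
  and tau_one: "\<tau> 1 = 1"
  and tau_pos: "a \<in> M \<Longrightarrow> \<tau> (adj a * a) \<in> \<real>\<^sub>\<ge>\<^sub>0"
  using state by (auto simp: state_on_def)

lemma tau_commute: "a \<in> M \<Longrightarrow> b \<in> M \<Longrightarrow> \<tau> (a * b) = \<tau> (b * a)"
  using tracial by (auto simp: tracial_on_def)

lemma tau_scaleR: "a \<in> M \<Longrightarrow> \<tau> (r *\<^sub>R a) = of_real r * \<tau> a"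
  by (simp add: scaleR_cop_eq_scaleC tau_scaleC)

lemma tau_zero: "\<tau> 0 = 0"
  using tau_scaleR [OF one_mem, of 0] by simp

lemma tau_minus: "a \<in> M \<Longrightarrow> \<tau> (- a) = - \<tau> a"
  using tau_scaleR [of a "-1"] by simp

lemma tau_diff: "a \<in> M \<Longrightarrow> b \<in> M \<Longrightarrow> \<tau> (a - b) = \<tau> a - \<tau> b"
  using tau_add [of a "- b"] by (simp add: tau_minus)

lemma tau_sum: "(\<And>i. i \<in> I \<Longrightarrow> f i \<in> M) \<Longrightarrow> \<tau> (sum f I) = (\<Sum>i\<in>I. \<tau> (f i))"
  by (induction I rule: infinite_finite_induct) (simp_all add: tau_zero tau_add sum_mem)

lemmas tau_linear = tau_add tau_diff tau_minus tau_scaleC tau_scaleR tau_zero tau_one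

lemma Im_tau_pos: "a \<in> M \<Longrightarrow> Im (\<tau> (adj a * a)) = 0"
  and Re_tau_pos: "a \<in> M \<Longrightarrow> 0 \<le> Re (\<tau> (adj a * a))"
  using tau_pos [of a] by (auto simp: complex_nonneg_Reals_iff)

text \<open>Positivity makes \<open>\<tau> (adj b * b)\<close> real. For
  \<open>b = a + c *\<^sub>C 1\<close>, the choice \<open>c = 1\<close> settles the imaginary parts
  and \<open>c = \<i>\<close> the real parts.\<close>

lemma tau_adj:
  assumes a: "a \<in> M"
  shows "\<tau> (adj a) = cnj (\<tau> a)"
proof -
  have "adj (a + c *\<^sub>C 1) * (a + c *\<^sub>C 1) = adj a * a + c *\<^sub>C adj a + cnj c *\<^sub>C a + (cnj c * c) *\<^sub>C 1" for c
    by (simp add: adj_add adj_scaleC distrib_left distrib_right scaleC_cop_mult_left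
        scaleC_cop_mult_right)
      (rule cop_eqI, simp add: cop_apply_simps scaleC_scaleC scaleC_add_right mult.commute)
  then have "Im (\<tau> (adj a * a) + c * \<tau> (adj a) + cnj c * \<tau> a + cnj c * c) = 0" for c
    using Im_tau_pos [of "a + c *\<^sub>C 1"] a by (simp add: tau_linear)
  then have "Im (c * \<tau> (adj a) + cnj c * \<tau> a) = 0" for c
    using Im_tau_pos [OF a] by (simp add: algebra_simps)
  from this [of 1] this [of \<i>] show ?thesis by (simp add: complex_eq_iff)
qed

section \<open>The \<open>L\<^sup>2\<close> norm of the trace\<close>

abbreviation n2 :: "'h cop \<Rightarrow> real" where "n2 \<equiv> norm2 \<tau>"

lemma n2_nonneg [simp]: "a \<in> M \<Longrightarrow> 0 \<le> n2 a"
  by (simp add: norm2_def Re_tau_pos)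

lemma n2_power2: "a \<in> M \<Longrightarrow> (n2 a)\<^sup>2 = Re (\<tau> (adj a * a))"
  by (simp add: norm2_def Re_tau_pos)

lemma of_real_n2_power2: "a \<in> M \<Longrightarrow> complex_of_real ((n2 a)\<^sup>2) = \<tau> (adj a * a)"
  by (simp add: n2_power2 complex_eq_iff Im_tau_pos)

lemma n2_zero [simp]: "n2 0 = 0"
  by (simp add: norm2_def tau_zero)

lemma n2_adj: "a \<in> M \<Longrightarrow> n2 (adj a) = n2 a"
  by (simp add: norm2_def tau_commute [of a])

lemma n2_scaleC: "a \<in> M \<Longrightarrow> n2 (c *\<^sub>C a) = cmod c * n2 a"
proof -
  assume a: "a \<in> M"
  have "adj (c *\<^sub>C a) * (c *\<^sub>C a) = complex_of_real ((cmod c)\<^sup>2) *\<^sub>C (adj a * a)"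
    unfolding complex_norm_square
    by (simp add: adj_scaleC scaleC_cop_mult_left scaleC_cop_mult_right)
      (rule cop_eqI, simp add: cop_apply_simps scaleC_scaleC mult.commute)
  with a show ?thesis by (simp add: norm2_def tau_scaleC real_sqrt_mult)
qed

lemma n2_scaleR: "a \<in> M \<Longrightarrow> n2 (r *\<^sub>R a) = \<bar>r\<bar> * n2 a"
  by (simp add: scaleR_cop_eq_scaleC n2_scaleC)

lemma n2_minus: "a \<in> M \<Longrightarrow> n2 (- a) = n2 a"
  by (simp add: norm2_def adj_minus)

lemma tau_Cauchy_Schwarz:
  assumes a: "a \<in> M" and b: "b \<in> M"
  shows "cmod (\<tau> (adj a * b)) \<le> n2 a * n2 b"
proof -
  define z where "z = \<tau> (adj a * b)"
  have z': "\<tau> (adj b * a) = cnj z"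
    using tau_adj [of "adj a * b"] a b by (simp add: adj_mult z_def)
  have quad: "0 \<le> (n2 b)\<^sup>2 - 2 * t * (cmod z)\<^sup>2 + t\<^sup>2 * (cmod z)\<^sup>2 * (n2 a)\<^sup>2" for t
  proof -
    define c where "c = complex_of_real t * z"
    have "adj (b - c *\<^sub>C a) * (b - c *\<^sub>C a) =
        adj b * b - c *\<^sub>C (adj b * a) - cnj c *\<^sub>C (adj a * b) + (cnj c * c) *\<^sub>C (adj a * a)"
      by (simp add: adj_diff adj_scaleC algebra_simps scaleC_cop_mult_left scaleC_cop_mult_right)
        (rule cop_eqI, simp add: cop_apply_simps scaleC_scaleC scaleC_diff mult.commute)
    then have "\<tau> (adj (b - c *\<^sub>C a) * (b - c *\<^sub>C a)) =
        \<tau> (adj b * b) - c * cnj z - cnj c * z + cnj c * c * \<tau> (adj a * a)"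
      using a b by (simp add: tau_linear z' z_def [symmetric])
    also have "\<dots> = complex_of_real ((n2 b)\<^sup>2 - 2 * t * (cmod z)\<^sup>2 + t\<^sup>2 * (cmod z)\<^sup>2 * (n2 a)\<^sup>2)"
      using complex_norm_square [of z]
      by (simp add: of_real_n2_power2 [symmetric] a b c_def algebra_simps power2_eq_square)
    finally show ?thesis
      using Re_tau_pos [of "b - c *\<^sub>C a"] a b by simp
  qed
  \<comment> \<open>The optimal \<open>t\<close> in \<open>quad\<close> is
    \<open>1 / (n2 a)\<^sup>2\<close>. To include \<open>n2 a = 0\<close> the denominator is
    enlarged by \<open>s\<close>, chosen so that the loss is at most \<open>e\<close>.\<close>
  have "(cmod z)\<^sup>2 \<le> (n2 a)\<^sup>2 * (n2 b)\<^sup>2 + e" if "e > 0" for e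
  proof -
    define s where "s = e / ((n2 b)\<^sup>2 + 1)"
    have B: "(n2 b)\<^sup>2 + 1 > 0" by (simp add: add_nonneg_pos)
    have s: "s > 0" "(n2 b)\<^sup>2 * s \<le> e"
      using that B by (simp_all add: s_def field_simps)
    define A where "A = (n2 a)\<^sup>2 + s"
    have A: "A > 0" "(n2 a)\<^sup>2 \<le> A" using s by (simp_all add: A_def add_nonneg_pos)
    have "(1 / A)\<^sup>2 * (cmod z)\<^sup>2 * (n2 a)\<^sup>2 \<le> (1 / A)\<^sup>2 * (cmod z)\<^sup>2 * A"
      using A by (intro mult_left_mono) auto
    also have "\<dots> = (cmod z)\<^sup>2 / A" using A by (simp add: field_simps power2_eq_square)
    finally have "(cmod z)\<^sup>2 / A \<le> (n2 b)\<^sup>2"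
      using quad [of "1 / A"] by simp
    then have "(cmod z)\<^sup>2 \<le> (n2 b)\<^sup>2 * A" using A by (simp add: field_simps)
    also have "\<dots> \<le> (n2 a)\<^sup>2 * (n2 b)\<^sup>2 + e" using s by (simp add: A_def algebra_simps)
    finally show ?thesis .
  qed
  then have "(cmod z)\<^sup>2 \<le> (n2 a * n2 b)\<^sup>2"
    unfolding power_mult_distrib by (rule field_le_epsilon)
  then show ?thesis
    unfolding z_def by (rule power2_le_imp_le) (simp add: a b)
qed

lemma n2_triangle:
  assumes a: "a \<in> M" and b: "b \<in> M"
  shows "n2 (a + b) \<le> n2 a + n2 b"
proof (rule power2_le_imp_le)
  have "(n2 (a + b))\<^sup>2 = (n2 a)\<^sup>2 + Re (\<tau> (adj a * b)) + Re (\<tau> (adj b * a)) + (n2 b)\<^sup>2"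
    using a b by (simp add: n2_power2 adj_add algebra_simps tau_add)
  moreover have "Re (\<tau> (adj a * b)) \<le> n2 a * n2 b" "Re (\<tau> (adj b * a)) \<le> n2 b * n2 a"
    using tau_Cauchy_Schwarz [OF a b] tau_Cauchy_Schwarz [OF b a] complex_Re_le_cmod order_trans
    by blast+
  ultimately show "(n2 (a + b))\<^sup>2 \<le> (n2 a + n2 b)\<^sup>2"
    by (simp add: power2_sum mult.commute [of "n2 b"])
qed (use a b in simp)

lemma n2_triangle_diff: "a \<in> M \<Longrightarrow> b \<in> M \<Longrightarrow> n2 (a - b) \<le> n2 a + n2 b"
  using n2_triangle [of a "- b"] by (simp add: n2_minus)

lemma n2_power2_add_le: "a \<in> M \<Longrightarrow> b \<in> M \<Longrightarrow> (n2 (a + b))\<^sup>2 \<le> 2 * (n2 a)\<^sup>2 + 2 * (n2 b)\<^sup>2"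
proof -
  assume "a \<in> M" "b \<in> M"
  then have "(n2 (a + b))\<^sup>2 \<le> (n2 a + n2 b)\<^sup>2"
    by (intro power_mono n2_triangle) auto
  moreover have "0 \<le> (n2 a - n2 b)\<^sup>2" by simp
  ultimately show ?thesis by (simp add: power2_sum power2_diff)
qed

text \<open>For \<open>c > norm a\<close> the element \<open>c\<^sup>2 - adj a * a\<close> equals
  \<open>c\<^sup>2 y\<^sup>2\<close> with \<open>y\<close> self-adjoint in \<open>M\<close>, so
  \<open>(c * n2 b)\<^sup>2\<close> exceeds \<open>(n2 (a * b))\<^sup>2\<close> by
  \<open>(c * n2 (y * b))\<^sup>2\<close>. The strict inequality makes the series for
  \<open>y\<close> converge; afterwards \<open>c\<close> decreases to \<open>norm a\<close>.\<close>

lemma n2_mult_le: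
  assumes a: "a \<in> M" and b: "b \<in> M"
  shows "n2 (a * b) \<le> norm a * n2 b"
proof -
  have le: "n2 (a * b) \<le> c * n2 b" if c: "c > norm a" for c
  proof -
    have "c > 0" using c norm_ge_zero [of a] by linarith
    define x where "x = (1 / c\<^sup>2) *\<^sub>R (adj a * a)"
    define f where "f k = ((1/2 :: real) gchoose k) *\<^sub>R ((- 1) ^ k *\<^sub>R x ^ k)" for k
    define y where "y = suminf f"
    have "norm (adj a * a) \<le> (norm a)\<^sup>2"
      using norm_mult_ineq [of "adj a" a] by (simp add: power2_eq_square)
    also have "\<dots> < c\<^sup>2" using c by (intro power_strict_mono) auto
    finally have "norm x < 1" using \<open>c > 0\<close> by (simp add: x_def)
    then have f: "summable (\<lambda>k. norm (f k))" "y * y = 1 - x"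
      unfolding f_def y_def by (rule sqrt_one_minus_series)+
    have x: "x \<in> M" "adj x = x" using a by (simp_all add: x_def adj_scaleR adj_mult)
    have sums: "f sums y" unfolding y_def by (rule summable_sums [OF summable_norm_cancel [OF f(1)]])
    have "y \<in> M"
    proof (rule closed_sequentially [OF closed_M])
      show "(\<lambda>n. sum f {..<n}) \<longlonglongrightarrow> y" using sums by (simp add: sums_def)
      show "sum f {..<n} \<in> M" for n by (intro sum_mem) (simp add: f_def x)
    qed
    have "(\<lambda>k. adj (f k)) sums adj y"
      by (rule bounded_linear.sums [OF bounded_linear_adj sums])
    moreover have "adj (f k) = f k" for k by (simp add: f_def adj_scaleR adj_power x)
    ultimately have "f sums adj y" by simp
    then have "adj y = y" using sums by (rule sums_unique2)
    have "adj b * (adj a * a * b) = c\<^sup>2 *\<^sub>R (adj b * (x * b))"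
      using \<open>c > 0\<close> by (simp add: x_def)
    also have "x = 1 - y * y" using f(2) by simp
    also have "adj b * ((1 - y * y) * b) = adj b * b - adj (y * b) * (y * b)"
      by (simp add: adj_mult \<open>adj y = y\<close> algebra_simps)
    finally have "Re (\<tau> (adj b * (adj a * a * b))) = c\<^sup>2 * ((n2 b)\<^sup>2 - (n2 (y * b))\<^sup>2)"
      using a b \<open>y \<in> M\<close> by (simp add: tau_linear n2_power2)
    moreover have "(n2 (a * b))\<^sup>2 = Re (\<tau> (adj b * (adj a * a * b)))"
      using a b by (simp add: n2_power2 adj_mult mult.assoc)
    ultimately have "(n2 (a * b))\<^sup>2 \<le> (c * n2 b)\<^sup>2"
      by (simp add: power_mult_distrib mult_left_mono)
    then show ?thesis by (rule power2_le_imp_le) (use b \<open>c > 0\<close> in simp)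
  qed
  show ?thesis
  proof (cases "n2 b = 0")
    case True
    then show ?thesis using le [of "norm a + 1"] by simp
  next
    case False
    then have "n2 b > 0" using b n2_nonneg [OF b] by linarith
    then have "n2 (a * b) / n2 b \<le> c" if "norm a < c" for c
      using le [OF that] by (simp add: pos_divide_le_eq)
    then have "n2 (a * b) / n2 b \<le> norm a" by (rule dense_ge)
    then show ?thesis using \<open>n2 b > 0\<close> by (simp add: pos_divide_le_eq)
  qed
qed

lemma n2_mult_le': "a \<in> M \<Longrightarrow> b \<in> M \<Longrightarrow> n2 (a * b) \<le> n2 a * norm b"
  using n2_mult_le [of "adj b" "adj a"] n2_adj [of "a * b"] n2_adj [of a] by (simp add: adj_mult mult.commute)

lemma n2_one [simp]: "n2 1 = 1"
  by (simp add: norm2_def tau_one)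

lemma n2_le_norm: "a \<in> M \<Longrightarrow> n2 a \<le> norm a"
  using n2_mult_le [of a 1] by simp

lemma cmod_tau_le_n2: "a \<in> M \<Longrightarrow> cmod (\<tau> a) \<le> n2 a"
  using tau_Cauchy_Schwarz [of 1 a] by simp

lemma cmod_tau_le_norm: "a \<in> M \<Longrightarrow> cmod (\<tau> a) \<le> norm a"
  using cmod_tau_le_n2 n2_le_norm order_trans by blast

lemma n2_eq_0: "a \<in> M \<Longrightarrow> n2 a = 0 \<Longrightarrow> a = 0"
  using faithful of_real_n2_power2 [of a] by (auto simp: faithful_on_def)

text \<open>The defect \<open>1 - adj u * u\<close> is a projection of trace \<open>0\<close>.\<close>

lemma isometry_unitary:
  assumes u: "u \<in> M" and "u * adj u = 1"
  shows "adj u * u = 1"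
proof -
  define p where "p = 1 - adj u * u"
  have "adj u * u * (adj u * u) = adj u * (u * adj u) * u" by (simp add: mult.assoc)
  then have "adj p * p = p"
    by (simp add: p_def adj_diff adj_mult assms algebra_simps)
  then have "(n2 p)\<^sup>2 = Re (\<tau> p)" using u by (simp add: n2_power2 p_def)
  also have "\<tau> p = 0"
    using u assms tau_commute [of u "adj u"] by (simp add: p_def tau_linear)
  finally have "p = 0" using u by (intro n2_eq_0) (simp_all add: p_def)
  then show ?thesis by (simp add: p_def)
qed

end

section \<open>Free Brownian motion\<close>

lemma integral_odd:
  fixes f :: "real \<Rightarrow> real"
  assumes "\<And>y. f (- y) = - f y"
  shows "integral {- c..c} f = 0"
proof -
  have "integral {- c..c} f = integral {- c..c} (\<lambda>y. f (- y))"
    using Henstock_Kurzweil_Integration.integral_reflect_real [of c "- c" f] by simp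
  also have "\<dots> = - integral {- c..c} f" by (simp add: assms)
  finally show ?thesis by simp
qed

text \<open>The function \<open>y * (4 * v - y\<^sup>2) powr (3/2)\<close> vanishes at both ends and has derivative
  \<open>4 * (v - y\<^sup>2) * sqrt (4 * v - y\<^sup>2)\<close>.\<close>

lemma semicircle_second_moment:
  fixes v :: real
  assumes v: "v > 0"
  defines "c \<equiv> 2 * sqrt v" and "w \<equiv> \<lambda>y. sqrt (4 * v - y\<^sup>2) / (2 * pi * v)"
  shows "integral {- c..c} (\<lambda>y. y\<^sup>2 * w y) = v * integral {- c..c} w"
proof -
  have c: "c > 0" "c\<^sup>2 = 4 * v" using v by (simp_all add: c_def power_mult_distrib)
  have pos: "4 * v - y\<^sup>2 > 0" if "y \<in> {- c<..<c}" for y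
  proof -
    have "\<bar>y\<bar> < c" using that by auto
    then have "\<bar>y\<bar>\<^sup>2 < c\<^sup>2" by (intro power_strict_mono) auto
    then show ?thesis using c by simp
  qed
  define G where "G y = y * ((4 * v - y\<^sup>2) * sqrt (4 * v - y\<^sup>2)) / (8 * pi * v)" for y
  have "((\<lambda>y. (v - y\<^sup>2) * w y) has_integral G c - G (- c)) {- c..c}"
  proof (rule fundamental_theorem_of_calculus_interior)
    show "continuous_on {- c..c} G"
      unfolding G_def using v by (intro continuous_intros) auto
    fix y assume y: "y \<in> {- c<..<c}"
    define r where "r = sqrt (4 * v - y\<^sup>2)"
    have r: "r > 0" "4 * v - y\<^sup>2 = r\<^sup>2" using pos [OF y] by (simp_all add: r_def)
    have "(G has_real_derivative
        ((1 * ((4 * v - y\<^sup>2) * r) + y * ((- (2 * y)) * r + (4 * v - y\<^sup>2) * ((- (2 * y)) * (inverse r / 2))))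
          / (8 * pi * v))) (at y)"
    proof -
      have dw: "((\<lambda>y. 4 * v - y\<^sup>2) has_real_derivative - (2 * y)) (at y)"
        by (auto intro!: derivative_eq_intros)
      have ds: "((\<lambda>y. sqrt (4 * v - y\<^sup>2)) has_real_derivative (- (2 * y)) * (inverse r / 2)) (at y)"
        unfolding r_def using pos [OF y] by (auto intro!: derivative_eq_intros)
      show ?thesis
        unfolding G_def
        by (rule DERIV_cong [OF DERIV_cdivide [OF DERIV_mult [OF DERIV_ident DERIV_mult [OF dw ds]]]])
          (unfold r_def [symmetric], simp add: algebra_simps)
    qed
    moreover have "(1 * ((4 * v - y\<^sup>2) * r) + y * ((- (2 * y)) * r + (4 * v - y\<^sup>2) * ((- (2 * y)) * (inverse r / 2))))
          / (8 * pi * v) = (v - y\<^sup>2) * w y"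
    proof -
      have eq: "(4 * v - y\<^sup>2) * ((- (2 * y)) * (inverse r / 2)) = - y * r"
        unfolding r(2) using r(1) by (simp add: field_simps power2_eq_square)
      have w: "w y = r / (2 * pi * v)" by (simp add: w_def r_def)
      show ?thesis
        unfolding eq w using v by (simp add: field_simps power2_eq_square)
    qed
    ultimately show "(G has_vector_derivative (v - y\<^sup>2) * w y) (at y)"
      by (simp add: has_real_derivative_iff_has_vector_derivative)
  qed (use c in simp)
  then have "integral {- c..c} (\<lambda>y. (v - y\<^sup>2) * w y) = 0"
    using c by (simp add: G_def integral_unique)
  moreover have "w integrable_on {- c..c}" "(\<lambda>y. y\<^sup>2 * w y) integrable_on {- c..c}"
    unfolding w_def using v by (intro integrable_continuous_interval continuous_intros; simp)+
  ultimately show ?thesis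
    by (simp add: left_diff_distrib integral_diff integrable_on_mult_right)
qed

section \<open>Brownian increments against the past\<close>

locale free_bm = wstar_space +
  fixes B :: "real \<Rightarrow> 'a cop"
  assumes fbm: "free_brownian_motion M \<tau> B"
begin

abbreviation F :: "real \<Rightarrow> 'a cop set" where "F \<equiv> filtration B"

abbreviation dB :: "real \<Rightarrow> real \<Rightarrow> 'a cop" where "dB s t \<equiv> B t - B s"

lemma B_mem: "0 \<le> t \<Longrightarrow> B t \<in> M" and adj_B: "0 \<le> t \<Longrightarrow> adj (B t) = B t"
  using fbm by (auto simp: free_brownian_motion_def self_adjoint_part_def)

lemma F_algebra: "unital_star_subalgebra (F t)"
  unfolding filtration_def by (rule unital_star_subalgebra_vN_generated)

lemmas F_mem [simp] = unital_star_subalgebra.mem [OF F_algebra]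

lemma F_subset: "a \<in> F t \<Longrightarrow> a \<in> M"
proof -
  have "B ` {0..t} \<subseteq> M" using B_mem by auto
  then show "a \<in> F t \<Longrightarrow> a \<in> M"
    using vN_generated_least [OF von_neumann] by (auto simp: filtration_def)
qed

lemma F_mono: "a \<in> F s \<Longrightarrow> s \<le> t \<Longrightarrow> a \<in> F t"
  using vN_generated_mono [OF image_mono, of "{0..s}" "{0..t}" B] by (auto simp: filtration_def)

lemma B_F: "0 \<le> s \<Longrightarrow> s \<le> t \<Longrightarrow> B s \<in> F t"
  using subset_vN_generated [of "B ` {0..t}"] by (auto simp: filtration_def)

lemma tau_dB: "0 \<le> s \<Longrightarrow> s < t \<Longrightarrow> \<tau> (dB s t) = 0"
  and tau_dB2: "0 \<le> s \<Longrightarrow> s < t \<Longrightarrow> \<tau> (dB s t * dB s t) = complex_of_real (t - s)"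
proof -
  assume "0 \<le> s" "s < t"
  then have sc: "semicircular \<tau> (t - s) (dB s t)" and v: "t - s > 0"
    using fbm by (auto simp: free_brownian_motion_def)
  let ?w = "\<lambda>y. sqrt (4 * (t - s) - y\<^sup>2) / (2 * pi * (t - s))"
  let ?I = "integral {- 2 * sqrt (t - s)..2 * sqrt (t - s)}"
  have moment: "\<tau> (dB s t ^ k) = complex_of_real (?I (\<lambda>y. y ^ k * ?w y))" for k
    using sc by (simp add: semicircular_def)
  show "\<tau> (dB s t) = 0"
    using moment [of 1] integral_odd [of "\<lambda>y. y * ?w y" "2 * sqrt (t - s)"] by simp
  \<comment> \<open>The total mass of the semicircle density is read off the zeroth moment, so no
    integral of the density has to be computed.\<close>
  have "complex_of_real (?I ?w) = 1"
    using moment [of 0] unfolding power_0 mult_1_left tau_one by (rule sym)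
  then have "?I ?w = 1" unfolding of_real_eq_1_iff .
  moreover have "?I (\<lambda>y. y\<^sup>2 * ?w y) = (t - s) * ?I ?w"
    unfolding mult_minus_left by (rule semicircle_second_moment [OF v])
  ultimately have "\<tau> ((dB s t)\<^sup>2) = complex_of_real (t - s)"
    by (simp only: moment mult_1_right)
  then show "\<tau> (dB s t * dB s t) = complex_of_real (t - s)"
    by (simp only: power2_eq_square)
qed

text \<open>Freeness of the increments enters only here, through alternating words of two letters;
  \<open>a\<close> is centred first, and the subtracted multiple of 1 contributes nothing as
  \<open>\<tau> x = 0\<close>.\<close>

lemma tau_centred_mult:
  assumes s: "0 \<le> s" "s < t" and a: "a \<in> F s" and x: "x \<in> star_algebra {dB s t}" "x \<in> M"
    and "\<tau> x = 0"
  shows "\<tau> (a * x) = 0"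
proof -
  define a' where "a' = a - \<tau> a *\<^sub>C 1"
  have a': "a' \<in> F s" "\<tau> a' = 0" using a by (simp_all add: a'_def tau_linear F_subset)
  have "free_sets \<tau> {dB s t} (F s)"
    using fbm s by (auto simp: free_brownian_motion_def)
  then have "\<tau> (prod_list (map snd [(False, a'), (True, x)])) = 0"
    unfolding free_sets_def free_family_def
    by (rule allE [where x = "[(False, a'), (True, x)]"])
      (use a' x assms(6) in \<open>auto intro: star_algebra.generator\<close>)
  then have "\<tau> (a * x) - \<tau> a * \<tau> x = 0"
    using F_subset [OF a] x by (simp add: a'_def left_diff_distrib scaleC_cop_mult_left tau_linear)
  then show ?thesis using assms(6) by simp
qed

lemma tau_mult_dB:
  assumes "0 \<le> s" "s \<le> t" "a \<in> F s"
  shows "\<tau> (a * dB s t) = 0"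
\<comment> \<open>Empty intervals must be allowed, since partitions are only weakly
  increasing.\<close>
proof (cases "s < t")
  case True
  then show ?thesis
    using assms by (intro tau_centred_mult) (auto intro: star_algebra.generator simp: B_mem tau_dB)
qed (use assms tau_zero in auto)

lemma tau_mult_dB2:
  assumes s: "0 \<le> s" "s \<le> t" and a: "a \<in> F s"
  shows "\<tau> (a * (dB s t * dB s t)) = complex_of_real (t - s) * \<tau> a"
proof (cases "s < t")
  case True
  define x where "x = dB s t * dB s t + (- complex_of_real (t - s)) *\<^sub>C 1"
  have "x \<in> M" "\<tau> x = 0"
    using s True by (simp_all add: x_def B_mem tau_linear tau_dB2)
  moreover have "x \<in> star_algebra {dB s t}"
    unfolding x_def by (intro star_algebra.intros) simp_all
  ultimately have "\<tau> (a * x) = 0"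
    using s True a by (intro tau_centred_mult)
  moreover have "a * x = a * (dB s t * dB s t) + (- complex_of_real (t - s)) *\<^sub>C a"
    by (simp add: x_def distrib_left scaleC_cop_mult_right)
  ultimately have "\<tau> (a * (dB s t * dB s t)) + (- complex_of_real (t - s)) * \<tau> a = 0"
    using s F_subset [OF a] by (simp add: tau_add tau_scaleC B_mem)
  then show ?thesis by (simp add: algebra_simps)
qed (use assms tau_zero in auto)

text \<open>The longer increment is split where the shorter one ends, and the later piece is killed
  by freeness from everything before it. If the longer increment stands on the left, traciality
  first moves that piece to the right end.\<close>

lemma tau_mult_dB_dB:
  assumes "0 \<le> s" "s \<le> p" "s \<le> q" and g: "g \<in> F s"
  shows "\<tau> (g * (dB s p * dB s q)) = complex_of_real (min p q - s) * \<tau> g"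
proof -
  have M: "B s \<in> M" "B p \<in> M" "B q \<in> M" "g \<in> M"
    using assms by (auto simp: B_mem F_subset)
  show ?thesis
  proof (cases "p \<le> q")
    case True
    have "g * (dB s p * dB s q) = g * (dB s p * dB s p) + g * dB s p * dB p q"
      by (simp add: algebra_simps)
    moreover have "g * dB s p \<in> F p"
      using assms F_mono [OF g, of p] by (simp add: B_F)
    ultimately show ?thesis
      using assms M True tau_mult_dB2 [of s p g] tau_mult_dB [of p q "g * dB s p"]
      by (simp add: tau_add)
  next
    case False
    have "g * (dB s p * dB s q) = g * (dB s q * dB s q) + g * dB q p * dB s q"
      by (simp add: algebra_simps)
    moreover have "dB s q * g \<in> F q"
      using assms F_mono [OF g, of q] by (simp add: B_F)
    moreover have "\<tau> (g * dB q p * dB s q) = \<tau> (dB s q * g * dB q p)"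
      using M tau_commute [of "g * dB q p" "dB s q"] by (simp add: mult.assoc)
    ultimately show ?thesis
      using assms M False tau_mult_dB2 [of s q g] tau_mult_dB [of q p "dB s q * g"]
      by (simp add: tau_add)
  qed
qed

text \<open>The length of the intersection of \<open>{a..<b}\<close> and
  \<open>{c..<d}\<close>.\<close>

definition overlap :: "real \<Rightarrow> real \<Rightarrow> real \<Rightarrow> real \<Rightarrow> real"
  where "overlap a b c d = max 0 (min b d - max a c)"

text \<open>The part of the first increment before \<open>c\<close> belongs to \<open>F c\<close>
  and joins the coefficient of \<open>dB c d\<close>, giving 0. The part after \<open>c\<close> is
  carried around the trace until it meets \<open>dB c d\<close>. The case \<open>c < a\<close> will
  follow by complex conjugation.\<close>

lemma covariance_aux:
  assumes ab: "0 \<le> a" "a \<le> c" "a \<le> b" "c \<le> d" and V: "V \<in> F a" and W: "W \<in> F c"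
  shows "\<tau> (adj (V * dB a b) * (W * dB c d)) = complex_of_real (overlap a b c d) * \<tau> (adj V * W)"
proof -
  have M: "B a \<in> M" "B b \<in> M" "B c \<in> M" "B d \<in> M" "V \<in> M" "W \<in> M"
    using assms by (auto simp: B_mem F_subset)
  have Vc: "V \<in> F c" using F_mono [OF V] ab by simp
  have adjd: "adj (dB a b) = dB a b" using ab by (simp add: adj_diff adj_B)
  have eq: "\<tau> (adj (V * dB a b) * (W * dB c d)) = \<tau> (dB a b * adj V * W * dB c d)"
    by (simp add: adj_mult adjd mult.assoc)
  show ?thesis
  proof (cases "b \<le> c")
    case True
    have "dB a b * adj V * W \<in> F c"
      using Vc W ab True by (simp add: B_F)
    then show ?thesis
      using tau_mult_dB [of c d] True ab by (simp add: eq overlap_def)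
  next
    case False
    have "\<tau> (dB a b * adj V * W * dB c d) = \<tau> (dB a c * adj V * W * dB c d) + \<tau> (dB c b * (adj V * W * dB c d))"
      using M by (simp flip: tau_add) (simp add: algebra_simps)
    also have "\<tau> (dB a c * adj V * W * dB c d) = 0"
      using Vc W ab by (intro tau_mult_dB) (simp_all add: B_F)
    also have "\<tau> (dB c b * (adj V * W * dB c d)) = \<tau> (adj V * W * (dB c d * dB c b))"
      using M by (simp add: tau_commute [of "dB c b"] mult.assoc)
    also have "\<dots> = complex_of_real (min d b - c) * \<tau> (adj V * W)"
      using Vc W ab False by (intro tau_mult_dB_dB) simp_all
    finally show ?thesis
      using ab False by (simp add: eq overlap_def min.commute max_def)
  qed
qed

lemma covariance:
  assumes "0 \<le> a" "0 \<le> c" "a \<le> b" "c \<le> d" and "V \<in> F a" and "W \<in> F c"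
  shows "\<tau> (adj (V * dB a b) * (W * dB c d)) = complex_of_real (overlap a b c d) * \<tau> (adj V * W)"
proof (cases "a \<le> c")
  case True
  then show ?thesis using assms by (intro covariance_aux)
next
  case False
  have M: "V * dB a b \<in> M" "W * dB c d \<in> M" "V \<in> M" "W \<in> M"
    using assms by (auto simp: B_mem F_subset)
  have swap: "\<tau> (adj x * y) = cnj (\<tau> (adj y * x))" if "x \<in> M" "y \<in> M" for x y
    using that tau_adj [of "adj y * x"] by (simp add: adj_mult)
  have "\<tau> (adj (V * dB a b) * (W * dB c d)) = cnj (\<tau> (adj (W * dB c d) * (V * dB a b)))"
    using M by (intro swap)
  also have "\<dots> = cnj (complex_of_real (overlap c d a b) * \<tau> (adj W * V))"
    using assms False by (subst covariance_aux) auto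
  also have "\<dots> = complex_of_real (overlap a b c d) * \<tau> (adj V * W)"
    using M swap [of V W] by (simp add: overlap_def min.commute max.commute)
  finally show ?thesis .
qed

section \<open>Simple processes and the free stochastic integral\<close>

text \<open>A simple process is a list of triples \<open>(a, b, V)\<close>, standing for the sum of the processes
  with value \<open>V\<close> on \<open>[a, b)\<close> and \<open>0\<close> elsewhere; no partition is required, so that sums of simple
  processes are concatenations.\<close>

definition simple_on :: "real \<Rightarrow> real \<Rightarrow> (real \<times> real \<times> 'a cop) list \<Rightarrow> bool" where
  "simple_on c d xs \<longleftrightarrow> (\<forall>(a, b, V)\<in>set xs. c \<le> a \<and> a \<le> b \<and> b \<le> d \<and> V \<in> F a)"

definition proc :: "(real \<times> real \<times> 'a cop) list \<Rightarrow> real \<Rightarrow> 'a cop" where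
  "proc xs r = (\<Sum>(a, b, V)\<leftarrow>xs. indicat_real {a..<b} r *\<^sub>R V)"

definition stoch :: "(real \<times> real \<times> 'a cop) list \<Rightarrow> 'a cop" where
  "stoch xs = (\<Sum>(a, b, V)\<leftarrow>xs. V * dB a b)"

definition neg :: "(real \<times> real \<times> 'a cop) list \<Rightarrow> (real \<times> real \<times> 'a cop) list" where
  "neg xs = map (\<lambda>(a, b, V). (a, b, - V)) xs"

text \<open>Triples starting at \<open>t\<close> or later are dropped, since cutting them at
  \<open>t\<close> would reverse their endpoints.\<close>

definition before :: "real \<Rightarrow> (real \<times> real \<times> 'a cop) list \<Rightarrow> (real \<times> real \<times> 'a cop) list" where
  "before t xs = map (\<lambda>(a, b, V). (a, min b t, V)) (filter (\<lambda>(a, b, V). a < t) xs)"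

text \<open>No filtering here: a triple ending before \<open>t\<close> collapses to the empty
  interval at \<open>t\<close>, where the increment is 0.\<close>

definition after :: "real \<Rightarrow> (real \<times> real \<times> 'a cop) list \<Rightarrow> (real \<times> real \<times> 'a cop) list" where
  "after t xs = map (\<lambda>(a, b, V). (max a t, max b t, V)) xs"

lemma simple_on_Nil [simp]: "simple_on c d []"
  and simple_on_Cons [simp]: "simple_on c d ((a, b, V) # xs) \<longleftrightarrow>
    c \<le> a \<and> a \<le> b \<and> b \<le> d \<and> V \<in> F a \<and> simple_on c d xs"
  by (simp_all add: simple_on_def)

lemma simple_on_append [simp]: "simple_on c d (xs @ ys) \<longleftrightarrow> simple_on c d xs \<and> simple_on c d ys"
  unfolding simple_on_def set_append ball_Un by (rule refl)

lemma proc_Nil [simp]: "proc [] r = 0"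
  and proc_Cons [simp]: "proc ((a, b, V) # xs) r = indicat_real {a..<b} r *\<^sub>R V + proc xs r"
  and proc_append [simp]: "proc (xs @ ys) r = proc xs r + proc ys r"
  by (simp_all add: proc_def)

lemma stoch_Nil [simp]: "stoch [] = 0"
  and stoch_Cons [simp]: "stoch ((a, b, V) # xs) = V * dB a b + stoch xs"
  and stoch_append [simp]: "stoch (xs @ ys) = stoch xs + stoch ys"
  by (simp_all add: stoch_def)

lemma simple_on_neg [simp]: "simple_on c d xs \<Longrightarrow> simple_on c d (neg xs)"
  by (auto simp: simple_on_def neg_def)

lemma proc_neg [simp]: "proc (neg xs) r = - proc xs r"
  by (induction xs) (auto simp: neg_def)

lemma stoch_neg [simp]: "stoch (neg xs) = - stoch xs"
  by (induction xs) (auto simp: neg_def)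

lemma simple_on_before: "simple_on c d xs \<Longrightarrow> simple_on c t (before t xs)"
  by (auto simp: simple_on_def before_def)

lemma simple_on_after: "simple_on c d xs \<Longrightarrow> t \<le> d \<Longrightarrow> simple_on t d (after t xs)"
  by (auto simp: simple_on_def after_def intro: F_mono)

lemma proc_before: "r < t \<Longrightarrow> proc (before t xs) r = proc xs r"
  by (induction xs) (auto simp: before_def indicator_def)

lemma proc_after: "t \<le> r \<Longrightarrow> proc (after t xs) r = proc xs r"
  by (induction xs) (auto simp: after_def indicator_def)

lemma stoch_before_after: "simple_on c d xs \<Longrightarrow> stoch xs = stoch (before t xs) + stoch (after t xs)"
proof (induction xs)
  case (Cons x xs)
  obtain a b V where x: "x = (a, b, V)" by (cases x)
  with Cons have IH: "stoch xs = stoch (before t xs) + stoch (after t xs)" and ab: "a \<le> b" by auto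
  have "stoch (before t (x # xs)) = (if a < t then V * dB a (min b t) else 0) + stoch (before t xs)"
    "stoch (after t (x # xs)) = V * dB (max a t) (max b t) + stoch (after t xs)"
    by (simp_all add: x before_def after_def)
  moreover have "V * dB a b = (if a < t then V * dB a (min b t) else 0) + V * dB (max a t) (max b t)"
  proof (cases "a < t")
    case False
    then show ?thesis using ab by (simp add: max_absorb1)
  qed (simp add: min_def max_def right_diff_distrib)
  moreover have "stoch (x # xs) = V * dB a b + stoch xs" by (simp add: x)
  ultimately show ?case using IH by (simp only: add.assoc add.left_commute)
qed (simp add: before_def after_def)

lemma proc_end: "simple_on c d xs \<Longrightarrow> d \<le> r \<Longrightarrow> proc xs r = 0"
  by (induction xs) (auto simp: indicator_def)

lemma proc_mem [simp]: "simple_on c d xs \<Longrightarrow> proc xs r \<in> M"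
  by (induction xs) (auto simp: F_subset)

lemma stoch_mem [simp]: "simple_on c d xs \<Longrightarrow> 0 \<le> c \<Longrightarrow> stoch xs \<in> M"
  by (induction xs) (auto simp: F_subset B_mem)

lemma has_integral_indicator_product:
  assumes "c \<le> a" "a \<le> b" "b \<le> d" "c \<le> a'" "a' \<le> b'" "b' \<le> d"
  shows "((\<lambda>r. indicat_real {a..<b} r * indicat_real {a'..<b'} r) has_integral overlap a b a' b') {c..d}"
proof -
  let ?p = "max a a'" and ?q = "min b b'"
  have eq: "indicat_real {a..<b} r * indicat_real {a'..<b'} r = indicat_real {?p..<?q} r" for r
    by (auto simp: indicator_def)
  \<comment> \<open>Closing the interval changes the indicator at one point only; if
    \<open>?p > ?q\<close>, both versions are empty and the overlap is 0.\<close>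
  have "((\<lambda>r. if r \<in> {?p..?q} then 1 else 0) has_integral overlap a b a' b') {c..d}"
  proof (subst has_integral_restrict)
    show "((\<lambda>r. 1) has_integral overlap a b a' b') {?p..?q}"
      using has_integral_const_real [of "1::real" ?p ?q] by (simp add: overlap_def max_def)
  qed (use assms in auto)
  then show ?thesis
    unfolding eq
    by (rule has_integral_spike_finite [where S = "{?q}", rotated 2]) (auto simp: indicator_def)
qed

text \<open>The isometry is proved in polarised form because this is additive in each list
  separately; the two inductions then reduce it to \<open>covariance\<close> for single
  triples.\<close>

lemma has_integral_proc_product:
  assumes xs: "simple_on c d xs" and ys: "simple_on c d ys" and c: "0 \<le> c"
  shows "((\<lambda>r. Re (\<tau> (adj (proc xs r) * proc ys r))) has_integral
    Re (\<tau> (adj (stoch xs) * stoch ys))) {c..d}"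
  using xs
proof (induction xs)
  case (Cons x xs)
  obtain a b V where x: "x = (a, b, V)" by (cases x)
  have a: "c \<le> a" "a \<le> b" "b \<le> d" "V \<in> F a" "simple_on c d xs" and V: "V \<in> M"
    using Cons.prems by (auto simp: x F_subset)
  have "((\<lambda>r. indicat_real {a..<b} r * Re (\<tau> (adj V * proc ys r))) has_integral
    Re (\<tau> (adj (V * dB a b) * stoch ys))) {c..d}"
    using ys
  proof (induction ys)
    case (Cons y ys)
    obtain a' b' W where y: "y = (a', b', W)" by (cases y)
    have a': "c \<le> a'" "a' \<le> b'" "b' \<le> d" "W \<in> F a'" "simple_on c d ys" and W: "W \<in> M"
      using Cons.prems by (auto simp: y F_subset)
    have "((\<lambda>r. (indicat_real {a..<b} r * indicat_real {a'..<b'} r) * Re (\<tau> (adj V * W))) has_integral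
        overlap a b a' b' * Re (\<tau> (adj V * W))) {c..d}"
      by (intro has_integral_mult_left has_integral_indicator_product a a')
    also have "overlap a b a' b' * Re (\<tau> (adj V * W)) = Re (\<tau> (adj (V * dB a b) * (W * dB a' b')))"
      using a a' c by (simp add: covariance)
    finally have "((\<lambda>r. (indicat_real {a..<b} r * indicat_real {a'..<b'} r) * Re (\<tau> (adj V * W)) +
        indicat_real {a..<b} r * Re (\<tau> (adj V * proc ys r))) has_integral
        Re (\<tau> (adj (V * dB a b) * (W * dB a' b'))) + Re (\<tau> (adj (V * dB a b) * stoch ys))) {c..d}"
      using Cons.IH a' by (intro has_integral_add)
    moreover have "Re (\<tau> (adj V * proc ((a', b', W) # ys) r)) =
        indicat_real {a'..<b'} r * Re (\<tau> (adj V * W)) + Re (\<tau> (adj V * proc ys r))" for r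
      using V W a' by (simp add: distrib_left tau_add tau_scaleR)
    moreover have "Re (\<tau> (adj (V * dB a b) * stoch ((a', b', W) # ys))) =
        Re (\<tau> (adj (V * dB a b) * (W * dB a' b'))) + Re (\<tau> (adj (V * dB a b) * stoch ys))"
      using V W a a' c by (simp add: distrib_left tau_add B_mem)
    ultimately show ?case by (simp add: y distrib_left mult.assoc)
  qed (simp add: tau_zero)
  then have "((\<lambda>r. indicat_real {a..<b} r * Re (\<tau> (adj V * proc ys r)) +
      Re (\<tau> (adj (proc xs r) * proc ys r))) has_integral
      Re (\<tau> (adj (V * dB a b) * stoch ys)) + Re (\<tau> (adj (stoch xs) * stoch ys))) {c..d}"
    using Cons.IH a by (intro has_integral_add)
  moreover have "Re (\<tau> (adj (proc ((a, b, V) # xs) r) * proc ys r)) =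
      indicat_real {a..<b} r * Re (\<tau> (adj V * proc ys r)) + Re (\<tau> (adj (proc xs r) * proc ys r))" for r
    using V a ys by (simp add: distrib_right adj_add adj_scaleR tau_add tau_scaleR)
  moreover have "Re (\<tau> (adj (stoch ((a, b, V) # xs)) * stoch ys)) =
      Re (\<tau> (adj (V * dB a b) * stoch ys)) + Re (\<tau> (adj (stoch xs) * stoch ys))"
    using V a ys c by (simp add: distrib_right adj_add tau_add B_mem)
  ultimately show ?case by (simp add: x)
qed (simp add: tau_zero)

lemma ito_isometry:
  assumes "simple_on c d xs" and "0 \<le> c"
  shows "((\<lambda>r. (n2 (proc xs r))\<^sup>2) has_integral (n2 (stoch xs))\<^sup>2) {c..d}"
  unfolding n2_power2 [OF proc_mem [OF assms(1)]] n2_power2 [OF stoch_mem [OF assms]]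
  by (rule has_integral_proc_product [OF assms(1,1,2)])

lemma tau_mult_stoch:
  assumes "a \<in> F c" "0 \<le> c" and "simple_on c d xs"
  shows "\<tau> (a * stoch xs) = 0"
  using assms(3)
proof (induction xs)
  case (Cons x xs)
  obtain p q V where x: "x = (p, q, V)" by (cases x)
  have p: "c \<le> p" "p \<le> q" "V \<in> F p" "simple_on c d xs" "a \<in> F p"
    using Cons.prems F_mono [OF assms(1)] by (auto simp: x)
  have "\<tau> (a * V * dB p q) = 0"
    using p assms(2) by (intro tau_mult_dB) auto
  then show ?case
    using Cons.IH p assms by (simp add: x distrib_left tau_add B_mem F_subset mult.assoc)
qed (simp add: tau_zero)

text \<open>Compared with \<open>has_free_ito_integral\<close>, the interval is arbitrary and the
  approximating sequence is explicit, so that increments of the integral have the same form.\<close>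

definition ito_approx ::
    "(real \<Rightarrow> 'a cop) \<Rightarrow> real \<Rightarrow> real \<Rightarrow> 'a cop \<Rightarrow> (nat \<Rightarrow> (real \<times> real \<times> 'a cop) list) \<Rightarrow> bool" where
  "ito_approx X c d Y xs \<longleftrightarrow> Y \<in> M \<and> (\<forall>k. simple_on c d (xs k)) \<and>
     (\<forall>k. (\<lambda>r. (n2 (X r - proc (xs k) r))\<^sup>2) integrable_on {c..d}) \<and>
     (\<lambda>k. integral {c..d} (\<lambda>r. (n2 (X r - proc (xs k) r))\<^sup>2)) \<longlonglongrightarrow> 0 \<and>
     (\<lambda>k. n2 (Y - stoch (xs k))) \<longlonglongrightarrow> 0"

lemma has_free_ito_integral_approx:
  assumes "has_free_ito_integral M \<tau> B X t Y"
  obtains xs where "ito_approx X 0 t Y xs"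
proof -
  obtain m s V e where Y: "Y \<in> M"
    and ad: "\<And>k::nat. adapted_step B t (m k) (s k) (V k)"
    and int: "\<And>k. ((\<lambda>r. (n2 (X r - step_process (m k) (s k) (V k) r))\<^sup>2) has_integral e k) {0..t}"
    and e: "e \<longlonglongrightarrow> 0"
    and lim: "(\<lambda>k. n2 (Y - step_integral B (m k) (s k) (V k))) \<longlonglongrightarrow> 0"
    using assms unfolding has_free_ito_integral_def by blast
  define xs where "xs k = map (\<lambda>j. (s k j, s k (Suc j), V k j)) [0..<m k]" for k
  have p: "proc (xs k) = step_process (m k) (s k) (V k)" for k
    by (simp add: fun_eq_iff proc_def xs_def step_process_def o_def interv_sum_list_conv_sum_set_nat
        atLeast0LessThan)
  have i: "stoch (xs k) = step_integral B (m k) (s k) (V k)" for k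
    by (simp add: stoch_def xs_def step_integral_def o_def interv_sum_list_conv_sum_set_nat
        atLeast0LessThan)
  have mono: "s k i \<le> s k j" if "i \<le> j" "j \<le> m k" for k i j
    using that
  proof (induction j rule: dec_induct)
    case (step j)
    then have "s k j \<le> s k (Suc j)" using ad [of k] by (simp add: adapted_step_def)
    with step show ?case by simp
  qed simp
  have "simple_on 0 t (xs k)" for k
    using ad [of k] mono [of 0 _ k] mono [of _ "m k" k]
    by (auto simp: simple_on_def xs_def adapted_step_def Suc_le_eq)
  then have "ito_approx X 0 t Y xs"
    using Y int e lim integral_unique [OF int]
    by (auto simp: ito_approx_def p i)
  then show ?thesis by (rule that)
qed

text \<open>The integrals up to \<open>t\<close> and up to \<open>T\<close> come with unrelated
  approximating sequences. On \<open>[0, t]\<close> both \<open>ys\<close> and the truncated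
  \<open>zs\<close> approximate \<open>X\<close>, so by the isometry their stochastic integrals
  become equal in the limit, and the remainder of \<open>zs\<close> approximates the
  increment.\<close>

lemma ito_approx_increment:
  assumes ys: "ito_approx X 0 t Y ys" and zs: "ito_approx X 0 T Z zs" and t: "0 \<le> t" "t \<le> T"
    and X: "\<And>r. 0 \<le> r \<Longrightarrow> r \<le> T \<Longrightarrow> X r \<in> M"
  shows "ito_approx X t T (Z - Y) (\<lambda>k. after t (zs k))"
proof -
  have M: "Y \<in> M" "Z \<in> M" and sy: "\<And>k. simple_on 0 t (ys k)" and sz: "\<And>k. simple_on 0 T (zs k)"
    using ys zs by (auto simp: ito_approx_def)
  note sb = simple_on_before [OF sz, of t] and sa = simple_on_after [OF sz t(2)]
  define f where "f k r = (n2 (X r - proc (ys k) r))\<^sup>2" for k r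
  define g where "g k r = (n2 (X r - proc (zs k) r))\<^sup>2" for k r
  have f: "f k integrable_on {0..t}" "(\<lambda>k. integral {0..t} (f k)) \<longlonglongrightarrow> 0"
    and g: "g k integrable_on {0..T}" "(\<lambda>k. integral {0..T} (g k)) \<longlonglongrightarrow> 0" for k
    using ys zs by (auto simp: ito_approx_def f_def [abs_def] g_def [abs_def])
  have g1: "g k integrable_on {0..t}" and g2: "g k integrable_on {t..T}" for k
    using t by (auto intro: integrable_subinterval_real [OF g(1)])
  have split: "integral {0..t} (g k) + integral {t..T} (g k) = integral {0..T} (g k)" for k
    using t g(1) by (rule Henstock_Kurzweil_Integration.integral_combine)
  have nonneg: "0 \<le> integral {0..t} (g k)" "0 \<le> integral {t..T} (g k)" for k
    using g1 g2 by (auto intro!: integral_nonneg simp: g_def)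
  have g1_lim: "(\<lambda>k. integral {0..t} (g k)) \<longlonglongrightarrow> 0"
    by (rule tendsto_sandwich [OF _ _ tendsto_const g(2)])
      (use nonneg split in \<open>auto intro!: always_eventually simp flip: split\<close>)
  have g2_lim: "(\<lambda>k. integral {t..T} (g k)) \<longlonglongrightarrow> 0"
    by (rule tendsto_sandwich [OF _ _ tendsto_const g(2)])
      (use nonneg split in \<open>auto intro!: always_eventually simp flip: split\<close>)
  have after_eq: "(n2 (X r - proc (after t (zs k)) r))\<^sup>2 = g k r" if "r \<in> {t..T}" for k r
    using that by (simp add: proc_after g_def)
  define D where "D k = stoch (before t (zs k)) - stoch (ys k)" for k
  have D_mem: "D k \<in> M" for k
    using stoch_mem [OF sb] stoch_mem [OF sy] by (simp add: D_def)
  have D_le: "(n2 (D k))\<^sup>2 \<le> 2 * integral {0..t} (f k) + 2 * integral {0..t} (g k)" for k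
  proof (rule has_integral_le)
    let ?xs = "before t (zs k) @ neg (ys k)"
    have "((\<lambda>r. (n2 (proc ?xs r))\<^sup>2) has_integral (n2 (stoch ?xs))\<^sup>2) {0..t}"
      by (rule ito_isometry) (simp_all add: sb sy)
    then show "((\<lambda>r. (n2 (proc (before t (zs k)) r - proc (ys k) r))\<^sup>2) has_integral (n2 (D k))\<^sup>2) {0..t}"
      by (simp add: D_def)
    show "((\<lambda>r. 2 * f k r + 2 * g k r) has_integral
        2 * integral {0..t} (f k) + 2 * integral {0..t} (g k)) {0..t}"
      by (intro has_integral_add has_integral_mult_right integrable_integral f g1)
    show "(n2 (proc (before t (zs k)) r - proc (ys k) r))\<^sup>2 \<le> 2 * f k r + 2 * g k r"
      if r: "r \<in> {0..t}" for r
    \<comment> \<open>At the endpoint \<open>r = t\<close> truncation does alter \<open>zs\<close>,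
      but there both simple processes vanish, their intervals being half open.\<close>
    proof (cases "r < t")
      case True
      have m: "X r - proc (ys k) r \<in> M" "X r - proc (zs k) r \<in> M"
        using X [of r] r t proc_mem [OF sy] proc_mem [OF sz] by auto
      have "proc (before t (zs k)) r - proc (ys k) r =
          (X r - proc (ys k) r) + - (X r - proc (zs k) r)"
        using True by (simp add: proc_before)
      then show ?thesis
        using n2_power2_add_le [OF m(1) minus_mem [OF m(2)]]
        by (simp only: n2_minus [OF m(2)] f_def g_def)
    next
      case False
      then show ?thesis
        using r by (simp add: proc_end [OF sb] proc_end [OF sy] f_def g_def)
    qed
  qed
  have D_lim: "(\<lambda>k. n2 (D k)) \<longlonglongrightarrow> 0"
  proof (rule tendsto_sandwich [OF _ _ tendsto_const])
    show "\<forall>\<^sub>F k in sequentially. 0 \<le> n2 (D k)" using D_mem by simp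
    show "(\<lambda>k. sqrt (2 * integral {0..t} (f k) + 2 * integral {0..t} (g k))) \<longlonglongrightarrow> 0"
      using f(2) g1_lim by (auto intro!: tendsto_eq_intros)
    show "\<forall>\<^sub>F k in sequentially. n2 (D k) \<le> sqrt (2 * integral {0..t} (f k) + 2 * integral {0..t} (g k))"
      using D_le by (auto intro!: always_eventually real_le_rsqrt)
  qed
  have "(\<lambda>k. n2 (Z - stoch (zs k)) + n2 (Y - stoch (ys k)) + n2 (D k)) \<longlonglongrightarrow> 0 + 0 + 0"
    using ys zs D_lim by (intro tendsto_add) (auto simp: ito_approx_def)
  then have "(\<lambda>k. n2 (Z - stoch (zs k)) + n2 (Y - stoch (ys k)) + n2 (D k)) \<longlonglongrightarrow> 0" by simp
  then have "(\<lambda>k. n2 (Z - Y - stoch (after t (zs k)))) \<longlonglongrightarrow> 0"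
  proof (rule tendsto_sandwich [OF _ _ tendsto_const, rotated 2])
    have m: "Z - stoch (zs k) \<in> M" "Y - stoch (ys k) \<in> M" "stoch (after t (zs k)) \<in> M" for k
      using M stoch_mem [OF sy] stoch_mem [OF sz] stoch_mem [OF sa] t by auto
    show "\<forall>\<^sub>F k in sequentially. 0 \<le> n2 (Z - Y - stoch (after t (zs k)))"
      using M m by (intro always_eventually) simp
    have "n2 (Z - Y - stoch (after t (zs k))) \<le>
        n2 (Z - stoch (zs k)) + n2 (Y - stoch (ys k)) + n2 (D k)" for k
    proof -
      have "Z - Y - stoch (after t (zs k)) = (Z - stoch (zs k)) - (Y - stoch (ys k)) + D k"
        using stoch_before_after [OF sz, of k t] by (simp add: D_def)
      also have "n2 \<dots> \<le> n2 ((Z - stoch (zs k)) - (Y - stoch (ys k))) + n2 (D k)"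
        using m D_mem by (intro n2_triangle) (auto simp del: diff_diff_eq2)
      also have "n2 ((Z - stoch (zs k)) - (Y - stoch (ys k))) \<le> n2 (Z - stoch (zs k)) + n2 (Y - stoch (ys k))"
        using m by (intro n2_triangle_diff) auto
      finally show ?thesis by simp
    qed
    then show "\<forall>\<^sub>F k in sequentially. n2 (Z - Y - stoch (after t (zs k))) \<le>
        n2 (Z - stoch (zs k)) + n2 (Y - stoch (ys k)) + n2 (D k)"
      by (intro always_eventually) blast
  qed
  moreover have "(\<lambda>r. (n2 (X r - proc (after t (zs k)) r))\<^sup>2) integrable_on {t..T}" for k
    using g2 [of k] after_eq by (subst integrable_cong [where g = "g k"]) auto
  moreover have "integral {t..T} (\<lambda>r. (n2 (X r - proc (after t (zs k)) r))\<^sup>2) = integral {t..T} (g k)" for k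
    using after_eq by (intro integral_cong) auto
  ultimately show ?thesis
    using M sa g2_lim by (simp add: ito_approx_def)
qed

text \<open>Freezing the integrand at \<open>V\<close> costs, by the isometry, at most the
  \<open>L\<^sup>2\<close> distance of the integrands; the factor 2 comes from the crude bound for
  the square of a sum.\<close>

lemma ito_approx_dist:
  assumes xs: "ito_approx X t T D xs" and t: "0 \<le> t" "t \<le> T" and V: "V \<in> F t"
    and X: "\<And>r. t \<le> r \<Longrightarrow> r \<le> T \<Longrightarrow> X r \<in> M \<and> n2 (X r - V) \<le> e"
  shows "n2 (D - V * dB t T) \<le> sqrt (2 * e\<^sup>2 * (T - t))"
proof -
  have D: "D \<in> M" and sx: "\<And>k. simple_on t T (xs k)" and VM: "V \<in> M"
    using xs F_subset [OF V] by (auto simp: ito_approx_def)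
  have e: "0 \<le> e" using X [of t] t VM order_trans [OF n2_nonneg, of "X t - V" e] by simp
  define f where "f k r = (n2 (X r - proc (xs k) r))\<^sup>2" for k r
  have f: "f k integrable_on {t..T}" "(\<lambda>k. integral {t..T} (f k)) \<longlonglongrightarrow> 0" for k
    using xs by (auto simp: ito_approx_def f_def [abs_def])
  have le: "(n2 (stoch (xs k) - V * dB t T))\<^sup>2 \<le> 2 * integral {t..T} (f k) + 2 * e\<^sup>2 * (T - t)" for k
  proof (rule has_integral_le)
    let ?xs = "xs k @ neg [(t, T, V)]"
    have sV: "simple_on t T [(t, T, V)]" using t V by simp
    have "((\<lambda>r. (n2 (proc ?xs r))\<^sup>2) has_integral (n2 (stoch ?xs))\<^sup>2) {t..T}"
      using t by (intro ito_isometry) (simp_all only: simple_on_append simple_on_neg sV sx)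
    then show "((\<lambda>r. (n2 (proc (xs k) r - indicat_real {t..<T} r *\<^sub>R V))\<^sup>2) has_integral
        (n2 (stoch (xs k) - V * dB t T))\<^sup>2) {t..T}"
      by simp
    show "((\<lambda>r. 2 * f k r + 2 * e\<^sup>2) has_integral 2 * integral {t..T} (f k) + 2 * e\<^sup>2 * (T - t)) {t..T}"
      using has_integral_const_real [of "2 * e\<^sup>2" t T] t
      by (intro has_integral_add has_integral_mult_right integrable_integral f) (simp add: mult.commute)
    show "(n2 (proc (xs k) r - indicat_real {t..<T} r *\<^sub>R V))\<^sup>2 \<le> 2 * f k r + 2 * e\<^sup>2"
      if r: "r \<in> {t..T}" for r
    proof (cases "r < T")
      case True
      have m: "X r - V \<in> M" "X r - proc (xs k) r \<in> M"
        using X [of r] r t proc_mem [OF sx] VM by auto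
      have "proc (xs k) r - indicat_real {t..<T} r *\<^sub>R V = (X r - V) + - (X r - proc (xs k) r)"
        using True r by simp
      then have "(n2 (proc (xs k) r - indicat_real {t..<T} r *\<^sub>R V))\<^sup>2 \<le> 2 * (n2 (X r - V))\<^sup>2 + 2 * f k r"
        using n2_power2_add_le [OF m(1) minus_mem [OF m(2)]]
        by (simp only: n2_minus [OF m(2)] f_def)
      moreover have "(n2 (X r - V))\<^sup>2 \<le> e\<^sup>2"
        using X [of r] r m by (intro power_mono) auto
      ultimately show ?thesis by simp
    next
      case False
      then show ?thesis using r by (simp add: proc_end [OF sx] f_def)
    qed
  qed
  have m: "D - stoch (xs k) \<in> M" "stoch (xs k) - V * dB t T \<in> M" for k
    using D stoch_mem [OF sx] VM t by (auto simp: B_mem)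
  have "(\<lambda>k. n2 (D - stoch (xs k)) + sqrt (2 * integral {t..T} (f k) + 2 * e\<^sup>2 * (T - t)))
      \<longlonglongrightarrow> 0 + sqrt (2 * 0 + 2 * e\<^sup>2 * (T - t))"
    using xs f(2) by (intro tendsto_intros) (auto simp: ito_approx_def)
  moreover have "n2 (D - V * dB t T) \<le>
      n2 (D - stoch (xs k)) + sqrt (2 * integral {t..T} (f k) + 2 * e\<^sup>2 * (T - t))" for k
    using n2_triangle [OF m(1) [of k] m(2) [of k]] real_le_rsqrt [OF le, of k] by simp
  ultimately show ?thesis
    by (intro LIMSEQ_le_const) auto
qed

text \<open>Orthogonality to the past holds for simple processes and survives the
  \<open>L\<^sup>2\<close> limit because \<open>a\<close> is bounded. It is exact, unlike the
  approximation in \<open>ito_approx_dist\<close>.\<close>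

lemma ito_approx_martingale:
  assumes xs: "ito_approx X t T D xs" and t: "0 \<le> t" and a: "a \<in> F t"
  shows "\<tau> (a * D) = 0"
proof -
  have D: "D \<in> M" "a \<in> M" and sx: "\<And>k. simple_on t T (xs k)"
    and lim: "(\<lambda>k. n2 (D - stoch (xs k))) \<longlonglongrightarrow> 0"
    using xs F_subset [OF a] by (auto simp: ito_approx_def)
  have "cmod (\<tau> (a * D)) \<le> norm a * n2 (D - stoch (xs k))" for k
  proof -
    have m: "stoch (xs k) \<in> M" using stoch_mem [OF sx t] .
    have "\<tau> (a * D) = \<tau> (a * (D - stoch (xs k)))"
      using D m tau_mult_stoch [OF a t sx] by (simp add: right_diff_distrib tau_diff)
    also have "cmod \<dots> \<le> n2 (a * (D - stoch (xs k)))"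
      using D m by (intro cmod_tau_le_n2) auto
    also have "\<dots> \<le> norm a * n2 (D - stoch (xs k))"
      using D m by (intro n2_mult_le) auto
    finally show ?thesis .
  qed
  moreover have "(\<lambda>k. norm a * n2 (D - stoch (xs k))) \<longlonglongrightarrow> norm a * 0"
    by (intro tendsto_intros lim)
  ultimately have "cmod (\<tau> (a * D)) \<le> norm a * 0"
    by (intro LIMSEQ_le_const) auto
  then show ?thesis by simp
qed

section \<open>Unitarity of the free unitary Brownian motion\<close>

text \<open>Separates the martingale increment \<open>J\<close> from the drift \<open>L\<close>. The
  distance bound on \<open>J\<close> serves terms quadratic in the increment, the orthogonality
  those linear in it.\<close>

lemma sde_increment:
  assumes sde: "solves_unitary_sde M \<tau> B U" and t: "0 \<le> t" "t \<le> s"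
    and small: "\<And>r. t \<le> r \<Longrightarrow> r \<le> s \<Longrightarrow> norm (U r - U t) \<le> e"
  obtains J L where "J \<in> M" "L \<in> M" "U s - U t = \<i> *\<^sub>C J - (1 / 2) *\<^sub>R L"
    and "n2 (J - U t * dB t s) \<le> sqrt (2 * e\<^sup>2 * (s - t))"
    and "\<And>a. a \<in> F t \<Longrightarrow> \<tau> (a * J) = 0"
    and "norm (L - (s - t) *\<^sub>R U t) \<le> e * (s - t)"
proof -
  have UF: "U r \<in> F r" if "0 \<le> r" for r using sde that by (simp add: solves_unitary_sde_def)
  then have UM: "U r \<in> M" if "0 \<le> r" for r using that F_subset by blast
  obtain Y D where Y: "has_free_ito_integral M \<tau> B U t Y" "(U has_integral D) {0..t}"
      "U t = 1 + \<i> *\<^sub>C Y - (1 / 2) *\<^sub>R D"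
    using sde t by (auto simp: solves_unitary_sde_def)
  obtain Y' D' where Y': "has_free_ito_integral M \<tau> B U s Y'" "(U has_integral D') {0..s}"
      "U s = 1 + \<i> *\<^sub>C Y' - (1 / 2) *\<^sub>R D'"
    using sde t unfolding solves_unitary_sde_def by (meson order_trans)
  obtain ys where ys: "ito_approx U 0 t Y ys" by (rule has_free_ito_integral_approx [OF Y(1)])
  obtain zs where zs: "ito_approx U 0 s Y' zs" by (rule has_free_ito_integral_approx [OF Y'(1)])
  define J where "J = Y' - Y"
  define L where "L = D' - D"
  have J: "ito_approx U t s J (\<lambda>k. after t (zs k))"
    unfolding J_def using t UM by (intro ito_approx_increment [OF ys zs]) auto
  have JM: "J \<in> M" using J by (simp add: ito_approx_def)
  have eq: "U s - U t = \<i> *\<^sub>C J - (1 / 2) *\<^sub>R L"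
    unfolding Y(3) Y'(3) J_def L_def
    by (rule cop_eqI) (simp add: cop_apply_simps scaleC_diff scaleR_diff_right)
  \<comment> \<open>Membership of the time integral in \<open>M\<close> is read off the equation
    itself.\<close>
  have "L = 2 *\<^sub>R (\<i> *\<^sub>C J - (U s - U t))" by (simp add: eq)
  then have LM: "L \<in> M" using JM UM t by simp
  have "continuous_on {t..s} U"
    using sde t by (auto simp: solves_unitary_sde_def intro: continuous_on_subset)
  then have "(U has_integral integral {t..s} U) {t..s}"
    by (intro integrable_integral integrable_continuous_interval)
  moreover from this have "D + integral {t..s} U = D'"
    using t Y(2) Y'(2) by (intro has_integral_unique [OF has_integral_combine])
  ultimately have "(U has_integral L) {t..s}" by (auto simp: L_def)
  then have "((\<lambda>r. U r - U t) has_integral L - (s - t) *\<^sub>R U t) {t..s}"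
    using has_integral_const_real [of "U t" t s] t by (intro has_integral_diff) simp_all
  then have L: "norm (L - (s - t) *\<^sub>R U t) \<le> e * (s - t)"
    using has_integral_bound_real [of e "{}" "\<lambda>r. U r - U t" _ t s] small t
      order_trans [OF norm_ge_zero small [of t]] by simp
  have "n2 (U r - U t) \<le> e" if "t \<le> r" "r \<le> s" for r
    using n2_le_norm [of "U r - U t"] small [OF that] UM [of r] UM [OF t(1)] that t by simp
  then have "n2 (J - U t * dB t s) \<le> sqrt (2 * e\<^sup>2 * (s - t))"
    using t UF UM by (intro ito_approx_dist [OF J]) auto
  then show ?thesis
    using that JM LM eq L ito_approx_martingale [OF J t(1)] by blast
qed

text \<open>In \<open>\<tau> (w * \<Delta>)\<close> the drift \<open>2 * p\<close> is cancelled by the It\^o correction \<open>q\<close> up to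
  \<open>o(h)\<close>, and the martingale part of \<open>\<Delta>\<close> vanishes, so that the square of the \<open>L\<^sup>2\<close> norm of \<open>\<Delta>\<close> is
  \<open>o(h)\<close> as well.\<close>

lemma sde_defect_increment:
  assumes sde: "solves_unitary_sde M \<tau> B U" and t: "0 \<le> t" "t \<le> s"
    and small: "\<And>r. t \<le> r \<Longrightarrow> r \<le> s \<Longrightarrow> norm (U r - U t) \<le> e"
    and K: "norm (U t) \<le> K" "1 \<le> K" and \<eta>: "2 * e + K * sqrt (s - t) \<le> \<eta>" "\<eta> \<le> 1"
  defines "N \<equiv> K\<^sup>2 + norm (1 :: 'a cop)"
  shows "\<bar>(n2 (U s * adj (U s) - 1))\<^sup>2 - (n2 (U t * adj (U t) - 1))\<^sup>2\<bar> \<le>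
    (6 * K * N + 2 * N + (3 * K + 1)\<^sup>2) * \<eta> * (s - t)"
proof -
  obtain J L where JL: "J \<in> M" "L \<in> M" and D_eq: "U s - U t = \<i> *\<^sub>C J - (1 / 2) *\<^sub>R L"
    and J: "n2 (J - U t * dB t s) \<le> sqrt (2 * e\<^sup>2 * (s - t))"
    and mart: "\<And>a. a \<in> F t \<Longrightarrow> \<tau> (a * J) = 0"
    and L: "norm (L - (s - t) *\<^sub>R U t) \<le> e * (s - t)"
    using sde_increment [OF sde t small] by blast
  define u h X D where "u = U t" and "h = s - t" and "X = dB t s" and "D = U s - U t"
  define E where "E = D - \<i> *\<^sub>C (u * X)"
  define w where "w = u * adj u - 1"
  define \<Delta> where "\<Delta> = (U s * adj (U s) - 1) - w"
  have uF: "u \<in> F t" using sde t by (simp add: solves_unitary_sde_def u_def)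
  have wF: "w \<in> F t" using uF by (simp add: w_def)
  have UsM: "U s \<in> M" using sde t F_subset [of "U s" s] by (simp add: solves_unitary_sde_def)
  have M: "u \<in> M" "w \<in> M" "X \<in> M" "D \<in> M" "E \<in> M" "\<Delta> \<in> M"
    using F_subset [OF uF] F_subset [OF wF] t UsM
    by (simp_all add: X_def B_mem D_def u_def E_def \<Delta>_def)
  have h: "0 \<le> h" using t by (simp add: h_def)
  have e: "0 \<le> e" using order_trans [OF norm_ge_zero small [of t]] t by simp
  have \<eta>0: "0 \<le> \<eta>" using \<eta>(1) e K(2) t by (smt (verit) mult_nonneg_nonneg real_sqrt_ge_zero)
  have e\<eta>: "e \<le> \<eta>" using \<eta>(1) e K(2) t by (smt (verit) mult_nonneg_nonneg real_sqrt_ge_zero)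
  have u_norm: "norm u \<le> K" using K by (simp add: u_def)
  have adjX: "adj X = X" using t by (simp add: X_def adj_diff adj_B)
  have adjw: "adj w = w" by (simp add: w_def adj_diff adj_mult)
  have w_norm: "norm w \<le> N"
  proof -
    have "norm w \<le> norm (u * adj u) + norm (1 :: 'a cop)" unfolding w_def by (rule norm_triangle_ineq4)
    also have "norm (u * adj u) \<le> norm u * norm u" using norm_mult_ineq [of u "adj u"] by simp
    also have "\<dots> \<le> K\<^sup>2" unfolding power2_eq_square using u_norm K by (intro mult_mono) auto
    finally show ?thesis by (simp add: N_def)
  qed
  have N: "0 \<le> N" using norm_ge_zero [of w] w_norm by linarith
  have n2X: "n2 X = sqrt h"
    using tau_mult_dB2 [OF t, of 1] unfolding norm2_def adjX
    by (simp add: X_def h_def tau_one)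
  have n2uX: "n2 (u * X) \<le> K * sqrt h"
  proof -
    have "n2 (u * X) \<le> norm u * n2 X" using M by (intro n2_mult_le)
    also have "\<dots> \<le> K * sqrt h" unfolding n2X using u_norm h by (intro mult_right_mono) auto
    finally show ?thesis .
  qed
  \<comment> \<open>\<open>E\<close> collects everything but the leading term
    \<open>\<i> *\<^sub>C (u * X)\<close>. In the bound defining \<open>\<eta>\<close>,
    \<open>2 * e\<close> pays for freezing the integrand and \<open>K * sqrt (s - t)\<close> for the
    drift, which has order \<open>h = sqrt h * sqrt h\<close>.\<close>
  have n2E: "n2 E \<le> \<eta> * sqrt h"
  proof -
    have E: "E = \<i> *\<^sub>C (J - u * X) - (1 / 2) *\<^sub>R L"
      unfolding E_def D_def D_eq by (rule cop_eqI) (simp add: cop_apply_simps scaleC_diff)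
    have "norm L \<le> norm (L - h *\<^sub>R u) + norm (h *\<^sub>R u)" 
      using norm_triangle_sub [of L "h *\<^sub>R u"] by (simp only: add.commute)
    also have "\<dots> \<le> e * h + h * K"
      using L u_norm h by (intro add_mono) (simp_all add: h_def u_def mult_left_mono)
    finally have "n2 ((1 / 2) *\<^sub>R L) \<le> (e * h + h * K) / 2"
      using n2_le_norm [OF JL(2)] JL by (simp add: n2_scaleR)
    also have "\<dots> \<le> h * K"
      using e\<eta> \<eta>(2) K(2) h mult_right_mono [of e K h] by (simp add: mult.commute)
    also have "\<dots> = K * sqrt h * sqrt h" using h by simp
    finally have "n2 ((1 / 2) *\<^sub>R L) \<le> K * sqrt h * sqrt h" .
    moreover have "n2 (\<i> *\<^sub>C (J - u * X)) \<le> 2 * e * sqrt h"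
    proof -
      have "n2 (\<i> *\<^sub>C (J - u * X)) \<le> sqrt (2 * e\<^sup>2 * h)"
        using J JL M by (simp add: n2_scaleC u_def X_def h_def)
      also have "\<dots> \<le> sqrt ((2 * e)\<^sup>2 * h)"
        using h by (intro real_sqrt_le_mono mult_right_mono) (auto simp: power2_eq_square)
      also have "\<dots> = 2 * e * sqrt h" using e by (simp add: real_sqrt_mult)
      finally show ?thesis .
    qed
    moreover have "n2 E \<le> n2 (\<i> *\<^sub>C (J - u * X)) + n2 ((1 / 2) *\<^sub>R L)"
      unfolding E using JL M by (intro n2_triangle_diff) simp_all
    ultimately have "n2 E \<le> (2 * e + K * sqrt h) * sqrt h"
      by (simp add: distrib_right)
    also have "\<dots> \<le> \<eta> * sqrt h"
      using \<eta>(1) h by (intro mult_right_mono) (simp_all add: h_def)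
    finally show ?thesis .
  qed
  have D_split: "D = \<i> *\<^sub>C (u * X) + E" by (simp add: E_def)
  have n2D: "n2 D \<le> (K + \<eta>) * sqrt h"
    using n2_triangle [of "\<i> *\<^sub>C (u * X)" E] M n2uX n2E
    by (simp add: D_split n2_scaleC distrib_right)
  have \<Delta>_eq: "\<Delta> = D * adj u + u * adj D + D * adj D"
    by (simp add: \<Delta>_def w_def D_def u_def adj_diff algebra_simps)
  \<comment> \<open>The leading terms cancel, as \<open>X\<close> is self-adjoint and
    \<open>\<i>\<close> changes sign under \<open>adj\<close>.\<close>
  have "D * adj u + u * adj D = E * adj u + u * adj E"
    by (simp add: D_split adj_add adj_scaleC adj_mult adjX distrib_left distrib_right
        scaleC_cop_mult_left scaleC_cop_mult_right mult.assoc)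
      (rule cop_eqI, simp add: cop_apply_simps scaleC_add_left [symmetric]
        scaleC_of_real [of 0, simplified] flip: add.assoc)
  then have \<Delta>_eq': "\<Delta> = E * adj u + u * adj E + D * adj D" by (simp add: \<Delta>_eq)
  have n2\<Delta>: "n2 \<Delta> \<le> (3 * K + 1) * \<eta> * sqrt h"
  proof -
    have "n2 (E * adj u) \<le> \<eta> * sqrt h * K"
      using n2_mult_le' [of E "adj u"] mult_mono [OF n2E u_norm] M h \<eta>0 by simp
    moreover have "n2 (u * adj E) \<le> K * (\<eta> * sqrt h)"
      using n2_mult_le [of u "adj E"] mult_mono [OF u_norm n2E] M K by (simp add: n2_adj)
    \<comment> \<open>Only one factor can be measured in \<open>L\<^sup>2\<close>; the other is
      small in operator norm by continuity of \<open>U\<close>.\<close>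
    moreover have "n2 (D * adj D) \<le> \<eta> * ((K + \<eta>) * sqrt h)"
    proof -
      have "norm D \<le> \<eta>" using small [of s] t e\<eta> by (simp add: D_def)
      then show ?thesis
        using n2_mult_le [of D "adj D"] mult_mono [OF _ n2D, of "norm D" \<eta>] M \<eta>0 by (simp add: n2_adj)
    qed
    moreover have "\<eta> * ((K + \<eta>) * sqrt h) \<le> \<eta> * ((K + 1) * sqrt h)"
      using \<eta>0 \<eta>(2) h by (intro mult_left_mono mult_right_mono) auto
    moreover have "n2 \<Delta> \<le> n2 (E * adj u) + n2 (u * adj E) + n2 (D * adj D)"
      unfolding \<Delta>_eq' using M
      by (intro order_trans [OF n2_triangle] add_right_mono n2_triangle) simp_all
    ultimately show ?thesis by (simp add: algebra_simps)
  qed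
  \<comment> \<open>To leading order the drift gives \<open>p = - h * c / 2\<close> and the second
    order term gives \<open>q = h * c\<close>, so \<open>2 * p + q\<close> cancels.\<close>
  define c where "c = Re (\<tau> (adj u * w * u))"
  define p where "p = Re (\<tau> (adj u * w * D))"
  define q where "q = Re (\<tau> (adj D * w * D))"
  \<comment> \<open>The bound on \<open>E\<close> would only give an error of order
    \<open>\<eta> * sqrt h\<close>. Instead the equation is inserted: \<open>J\<close> drops out by
    orthogonality and only the drift remainder \<open>L'\<close> is left.\<close>
  have p_err: "\<bar>p + h * c / 2\<bar> \<le> K * N * \<eta> * h / 2"
  proof -
    define L' where "L' = L - h *\<^sub>R u"
    have L'M: "L' \<in> M" using JL M by (simp add: L'_def)
    have "adj u * w * D = \<i> *\<^sub>C (adj u * w * J) - (h / 2) *\<^sub>R (adj u * w * u) - (1 / 2) *\<^sub>R (adj u * w * L')"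
      unfolding D_def D_eq L'_def
      by (simp add: right_diff_distrib scaleC_cop_mult_right scaleR_diff_right)
    moreover have "\<tau> (adj u * w * J) = 0" using uF wF by (intro mart) simp
    ultimately have "p + h * c / 2 = - Re (\<tau> (adj u * w * L')) / 2"
      using M JL L'M by (simp add: p_def c_def tau_linear)
    then have "\<bar>p + h * c / 2\<bar> \<le> cmod (\<tau> (adj u * w * L')) / 2"
      using abs_Re_le_cmod [of "\<tau> (adj u * w * L')"] by simp
    also have "\<dots> \<le> norm (adj u * w * L') / 2"
      using M L'M cmod_tau_le_norm [of "adj u * w * L'"] by simp
    also have "norm (adj u * w * L') \<le> norm (adj u * w) * norm L'" by (rule norm_mult_ineq)
    also have "\<dots> \<le> K * N * (\<eta> * h)"
    proof (rule mult_mono)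
      show "norm (adj u * w) \<le> K * N"
        using norm_mult_ineq [of "adj u" w] mult_mono [OF u_norm w_norm] K by simp
      show "norm L' \<le> \<eta> * h"
        using L mult_right_mono [OF e\<eta> h] by (simp add: L'_def h_def u_def)
    qed (use K N in auto)
    finally show ?thesis by simp
  qed
  have q_err: "\<bar>q - h * c\<bar> \<le> (2 * K * N + N) * \<eta> * h"
  proof -
    define A where "A = \<i> *\<^sub>C (u * X)"
    have AM: "A \<in> M" using M by (simp add: A_def)
    have A: "n2 A \<le> K * sqrt h" using n2uX M by (simp add: A_def n2_scaleC)
    have "adj A * w * A = X * (adj u * w * u * X)"
      unfolding A_def adj_scaleC adj_mult adjX
      by (simp add: scaleC_cop_mult_left scaleC_cop_mult_right mult.assoc)
        (rule cop_eqI, simp add: cop_apply_simps scaleC_scaleC scaleC_of_real [of 1, simplified])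
    then have "\<tau> (adj A * w * A) = \<tau> (adj u * w * u * (X * X))"
      using M tau_commute [of X "adj u * w * u * X"] by (simp add: mult.assoc)
    also have "\<dots> = complex_of_real h * \<tau> (adj u * w * u)"
      unfolding X_def h_def using t uF wF by (intro tau_mult_dB2) simp_all
    finally have AA: "Re (\<tau> (adj A * w * A)) = h * c" by (simp add: c_def)
    have bd: "\<bar>Re (\<tau> (adj x * w * y))\<bar> \<le> a * (N * b)"
      if "x \<in> M" "y \<in> M" "n2 x \<le> a" "n2 y \<le> b" for x y a b
    proof -
      have "\<bar>Re (\<tau> (adj x * w * y))\<bar> \<le> cmod (\<tau> (adj x * (w * y)))"
        using abs_Re_le_cmod by (simp add: mult.assoc)
      also have "\<dots> \<le> n2 x * n2 (w * y)" using that M by (intro tau_Cauchy_Schwarz) simp_all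
      also have "\<dots> \<le> a * (N * b)"
      proof (rule mult_mono)
        have "n2 (w * y) \<le> norm w * n2 y" using that M by (intro n2_mult_le)
        also have "\<dots> \<le> N * b" using that w_norm N by (intro mult_mono) simp_all
        finally show "n2 (w * y) \<le> N * b" .
      qed (use that M order_trans [OF n2_nonneg, of x] in simp_all)
      finally show ?thesis .
    qed
    have "adj D * w * D = adj A * w * A + adj A * w * E + adj E * w * A + adj E * w * E"
      unfolding D_split A_def [symmetric] by (simp add: adj_add algebra_simps)
    then have "q = h * c + Re (\<tau> (adj A * w * E)) + Re (\<tau> (adj E * w * A)) + Re (\<tau> (adj E * w * E))"
      using AM M by (simp add: q_def tau_add AA)
    moreover have "\<bar>Re (\<tau> (adj A * w * E))\<bar> \<le> K * sqrt h * (N * (\<eta> * sqrt h))"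
      using AM M A n2E by (intro bd)
    moreover have "\<bar>Re (\<tau> (adj E * w * A))\<bar> \<le> \<eta> * sqrt h * (N * (K * sqrt h))"
      using AM M A n2E by (intro bd)
    moreover have "\<bar>Re (\<tau> (adj E * w * E))\<bar> \<le> \<eta> * sqrt h * (N * (\<eta> * sqrt h))"
      using AM M A n2E by (intro bd)
    moreover have "K * sqrt h * (N * (\<eta> * sqrt h)) = K * N * \<eta> * h"
      "\<eta> * sqrt h * (N * (K * sqrt h)) = K * N * \<eta> * h"
      "\<eta> * sqrt h * (N * (\<eta> * sqrt h)) = N * (\<eta> * \<eta>) * h"
      using h by (simp_all add: algebra_simps)
    moreover have "N * (\<eta> * \<eta>) * h \<le> N * (\<eta> * 1) * h"
      using N \<eta>0 \<eta>(2) h by (intro mult_left_mono mult_right_mono) auto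
    ultimately show ?thesis by (simp add: distrib_right)
  qed
  have "n2 (U s * adj (U s) - 1) = n2 (w + \<Delta>)" by (simp add: \<Delta>_def)
  moreover have "(n2 (w + \<Delta>))\<^sup>2 = (n2 w)\<^sup>2 + 2 * Re (\<tau> (w * \<Delta>)) + (n2 \<Delta>)\<^sup>2"
  proof -
    have "\<tau> (adj \<Delta> * w) = cnj (\<tau> (w * \<Delta>))"
      using M tau_adj [of "w * \<Delta>"] by (simp add: adj_mult adjw)
    then show ?thesis
      using M by (simp add: n2_power2 adj_add adjw distrib_left distrib_right tau_add)
  qed
  moreover have "Re (\<tau> (w * \<Delta>)) = 2 * p + q"
  proof -
    have 1: "\<tau> (w * (D * adj u)) = \<tau> (adj u * w * D)"
      using M tau_commute [of "adj u" "w * D"] by (simp add: mult.assoc)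
    have 2: "\<tau> (w * (u * adj D)) = cnj (\<tau> (adj u * w * D))"
      using M tau_adj [of "D * adj u * w"] tau_commute [of D "adj u * w"]
      by (simp add: adj_mult adjw mult.assoc)
    have 3: "\<tau> (w * (D * adj D)) = \<tau> (adj D * w * D)"
      using M tau_commute [of "adj D" "w * D"] by (simp add: mult.assoc)
    show ?thesis
      unfolding \<Delta>_eq using M by (simp add: distrib_left tau_add 1 2 3 p_def q_def)
  qed
  ultimately have "(n2 (U s * adj (U s) - 1))\<^sup>2 - (n2 (U t * adj (U t) - 1))\<^sup>2 =
      4 * (p + h * c / 2) + 2 * (q - h * c) + (n2 \<Delta>)\<^sup>2"
    by (simp add: w_def u_def algebra_simps)
  also have "\<bar>\<dots>\<bar> \<le> 4 * (K * N * \<eta> * h / 2) + 2 * ((2 * K * N + N) * \<eta> * h) + (3 * K + 1)\<^sup>2 * \<eta> * h"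
  proof -
    have "(n2 \<Delta>)\<^sup>2 \<le> ((3 * K + 1) * \<eta> * sqrt h)\<^sup>2"
      using n2\<Delta> M by (intro power_mono) simp_all
    also have "\<dots> = (3 * K + 1)\<^sup>2 * (\<eta> * \<eta>) * h"
      using h by (simp add: power_mult_distrib) (simp add: power2_eq_square)
    also have "\<dots> \<le> (3 * K + 1)\<^sup>2 * (\<eta> * 1) * h"
      using \<eta>0 \<eta>(2) h by (intro mult_left_mono mult_right_mono) auto
    finally have "(n2 \<Delta>)\<^sup>2 \<le> (3 * K + 1)\<^sup>2 * \<eta> * h" by simp
    moreover have "0 \<le> (n2 \<Delta>)\<^sup>2" by simp
    moreover have "\<bar>4 * a + 2 * b + d\<bar> \<le> 4 * a' + 2 * b' + d'"
      if "\<bar>a\<bar> \<le> a'" "\<bar>b\<bar> \<le> b'" "0 \<le> d" "d \<le> d'" for a b d a' b' d' :: real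
      using that by linarith
    ultimately show ?thesis using p_err q_err by blast
  qed
  also have "\<dots> = (6 * K * N + 2 * N + (3 * K + 1)\<^sup>2) * \<eta> * (s - t)"
    by (simp add: h_def [symmetric] field_simps)
  finally show ?thesis .
qed

lemma sde_coisometry:
  assumes sde: "solves_unitary_sde M \<tau> B U" and T: "0 \<le> T"
  shows "U T * adj (U T) = 1"
proof -
  define g where "g t = (n2 (U t * adj (U t) - 1))\<^sup>2" for t
  have cont: "continuous_on {0..T} U"
    using sde by (auto simp: solves_unitary_sde_def intro: continuous_on_subset)
  have "bounded (U ` {0..T})"
    by (intro compact_imp_bounded compact_continuous_image cont compact_Icc)
  then obtain K0 where "\<forall>x\<in>U ` {0..T}. norm x \<le> K0"
    unfolding bounded_iff by blast
  then have K0: "norm (U t) \<le> K0" if "t \<in> {0..T}" for t using that by blast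
  define K where "K = max 1 K0"
  have K: "1 \<le> K" "norm (U t) \<le> K" if "t \<in> {0..T}" for t
    using K0 [OF that] by (simp_all add: K_def)
  define N where "N = K\<^sup>2 + norm (1 :: 'a cop)"
  define C where "C = 6 * K * N + 2 * N + (3 * K + 1)\<^sup>2"
  have K1: "1 \<le> K" by (simp add: K_def)
  have "0 \<le> N" by (simp add: N_def)
  then have C: "0 < C"
    using K1 unfolding C_def by (intro add_nonneg_pos add_nonneg_nonneg mult_nonneg_nonneg) auto
  \<comment> \<open>The radius must be uniform in the base point:
    \<open>sde_defect_increment\<close> looks forward only, so at \<open>x\<close> the left-hand
    increments are estimated from base points \<open>y < x\<close>.\<close>
  have locally_small: "\<exists>d>0. \<forall>x\<in>{0..T}. \<forall>y\<in>{0..T}. \<bar>y - x\<bar> < d \<longrightarrow> \<bar>g y - g x\<bar> \<le> e * \<bar>y - x\<bar>"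
    if "e > 0" for e
  proof -
    define \<eta> where "\<eta> = min 1 (e / C)"
    have \<eta>: "0 < \<eta>" "\<eta> \<le> 1" "C * \<eta> \<le> e"
      using that C by (auto simp: \<eta>_def field_simps min_def)
    obtain d where d: "d > 0"
      and d': "\<And>x y. x \<in> {0..T} \<Longrightarrow> y \<in> {0..T} \<Longrightarrow> dist y x < d \<Longrightarrow> dist (U y) (U x) < \<eta> / 4"
      using compact_uniformly_continuous [OF cont compact_Icc] \<eta>(1)
      unfolding uniformly_continuous_on_def by (metis zero_less_divide_iff zero_less_numeral)
    \<comment> \<open>With \<open>e = \<eta> / 4\<close>, the two summands \<open>2 * e\<close> and
      \<open>K * sqrt (y - x)\<close> each take at most half of \<open>\<eta>\<close>.\<close>
    define d0 where "d0 = min d ((\<eta> / (2 * K))\<^sup>2)"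
    have "d0 > 0" using d \<eta>(1) K1 by (simp add: d0_def)
    have le: "\<bar>g y - g x\<bar> \<le> e * (y - x)"
      if x: "x \<in> {0..T}" and y: "y \<in> {0..T}" and xy: "x \<le> y" "y - x < d0" for x y
    proof -
      have "norm (U r - U x) \<le> \<eta> / 4" if "x \<le> r" "r \<le> y" for r
      proof -
        have "r \<in> {0..T}" "dist r x < d" using that x y xy by (auto simp: dist_real_def d0_def)
        then show ?thesis using d' [of x r] x by (simp add: dist_norm less_imp_le)
      qed
      moreover have "sqrt (y - x) \<le> \<eta> / (2 * K)"
        using xy \<eta>(1) K1 by (intro real_le_lsqrt) (auto simp: d0_def)
      then have "2 * (\<eta> / 4) + K * sqrt (y - x) \<le> \<eta>"
        using K1 by (simp add: field_simps)
      ultimately have "\<bar>g y - g x\<bar> \<le> C * \<eta> * (y - x)"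
        unfolding g_def C_def N_def using x xy K1 K \<eta>
        by (intro sde_defect_increment [OF sde, where e = "\<eta> / 4"]) auto
      also have "\<dots> \<le> e * (y - x)" using \<eta>(3) xy by (intro mult_right_mono) auto
      finally show ?thesis .
    qed
    have "\<bar>g y - g x\<bar> \<le> e * \<bar>y - x\<bar>"
      if "x \<in> {0..T}" "y \<in> {0..T}" "\<bar>y - x\<bar> < d0" for x y
      using le [of x y] le [of y x] that by (cases "x \<le> y") (auto simp: abs_minus_commute)
    with \<open>d0 > 0\<close> show ?thesis by blast
  qed
  have "(g has_derivative (\<lambda>h. 0)) (at x within {0..T})" if x: "x \<in> {0..T}" for x
    unfolding has_derivative_within_alt2
  proof (intro conjI allI impI)
    fix e :: real assume "e > 0"
    then obtain d where d: "d > 0"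
      and le: "\<And>x y. x \<in> {0..T} \<Longrightarrow> y \<in> {0..T} \<Longrightarrow> \<bar>y - x\<bar> < d \<Longrightarrow> \<bar>g y - g x\<bar> \<le> e * \<bar>y - x\<bar>"
      using locally_small by metis
    show "\<forall>\<^sub>F y in at x within {0..T}. norm (g y - g x - 0) \<le> e * norm (y - x)"
      unfolding eventually_at using d le [OF x] by (intro exI [of _ d]) (auto simp: dist_real_def)
  qed simp
  then obtain c where c: "\<And>x. x \<in> {0..T} \<Longrightarrow> g x = c"
    using has_derivative_zero_constant [of "{0..T}" g] by auto
  have "g 0 = 0" using sde by (simp add: g_def solves_unitary_sde_def)
  then have "g T = 0" using c [of 0] c [of T] T by simp
  moreover have "U T \<in> M" using sde T F_subset [of "U T" T] by (simp add: solves_unitary_sde_def)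
  ultimately have "U T * adj (U T) - 1 = 0"
    by (intro n2_eq_0) (simp_all add: g_def)
  then show ?thesis by simp
qed

end

section \<open>Moments of a pair of projections\<close>

lemma binomial_power_one_plus:
  fixes W :: "'a::{real_normed_algebra,monoid_mult}"
  shows "(1 + W) ^ n = (\<Sum>j\<le>n. real (n choose j) *\<^sub>R W ^ j)"
proof (induction n)
  case (Suc n)
  have "(\<Sum>j\<le>Suc n. real (Suc n choose j) *\<^sub>R W ^ j) =
      1 + (\<Sum>j\<le>n. real (n choose j) *\<^sub>R W ^ Suc j) + (\<Sum>j\<le>n. real (n choose Suc j) *\<^sub>R W ^ Suc j)"
    by (subst sum.atMost_Suc_shift) (simp add: scaleR_left_distrib sum.distrib add.assoc)
  also have "(\<Sum>j\<le>n. real (n choose j) *\<^sub>R W ^ Suc j) = W * (1 + W) ^ n"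
    by (simp add: Suc sum_distrib_left)
  also have "1 + W * (1 + W) ^ n + (\<Sum>j\<le>n. real (n choose Suc j) *\<^sub>R W ^ Suc j) =
      W * (1 + W) ^ n + (\<Sum>j\<le>Suc n. real (n choose j) *\<^sub>R W ^ j)"
    by (subst sum.atMost_Suc_shift) simp
  also have "(\<Sum>j\<le>Suc n. real (n choose j) *\<^sub>R W ^ j) = (1 + W) ^ n"
    by (simp add: Suc binomial_eq_0)
  also have "W * (1 + W) ^ n + (1 + W) ^ n = (1 + W) ^ Suc n"
    by (simp add: distrib_right)
  finally show ?case by simp
qed simp

lemma power_mult_commute:
  fixes a b :: "'a::monoid_mult"
  assumes "a * b = b * a"
  shows "(a * b) ^ n = a ^ n * b ^ n"
proof (induction n)
  case (Suc n)
  have "b * a ^ n = a ^ n * b"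
    by (rule power_commuting_commutes [symmetric, OF assms])
  then show ?case by (simp add: Suc mult.assoc) (metis mult.assoc)
qed simp

lemma power_intertwine:
  fixes a b c :: "'a::monoid_mult"
  assumes "a * c = c * b"
  shows "a ^ n * c = c * b ^ n"
proof (induction n)
  case (Suc n)
  have "a ^ Suc n * c = a * (a ^ n * c)" by (simp add: mult.assoc)
  also have "\<dots> = (a * c) * b ^ n" by (simp add: Suc mult.assoc)
  also have "\<dots> = c * b ^ Suc n" by (simp add: assms mult.assoc)
  finally show ?case .
qed simp

lemma inverse_power_mult_power:
  fixes a b :: "'a::monoid_mult"
  assumes "b * a = 1"
  shows "b ^ n * a ^ (n + k) = a ^ k" and "b ^ (n + k) * a ^ n = b ^ k"
proof -
  show "b ^ n * a ^ (n + k) = a ^ k"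
  proof (induction n)
    case (Suc n)
    have "b ^ Suc n * a ^ (Suc n + k) = b ^ n * (b * a) * a ^ (n + k)"
      by (simp only: power_Suc2 [of b n] add_Suc power_Suc [of a] mult.assoc)
    then show ?case by (simp add: assms Suc)
  qed simp
  show "b ^ (n + k) * a ^ n = b ^ k"
  proof (induction n)
    case (Suc n)
    have "b ^ (Suc n + k) * a ^ Suc n = b ^ (n + k) * (b * a) * a ^ n"
      by (simp only: power_Suc2 [of b] add_Suc power_Suc [of a] mult.assoc)
    then show ?case by (simp add: assms Suc)
  qed simp
qed

context wstar_space
begin

text \<open>The words \<open>R * W ^ k\<close> are conjugate to \<open>R\<close> or to \<open>S\<close>, according to the parity of \<open>k\<close>.\<close>

lemma projection_pair_moments:
  assumes RM: "R \<in> M" and SM: "S \<in> M" and RR: "R * R = 1" and SS: "S * S = 1" and n: "n \<ge> 1"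
  defines "P \<equiv> (1 / 2) *\<^sub>R (1 + R)" and "Q \<equiv> (1 / 2) *\<^sub>R (1 + S)"
  shows "\<tau> ((P * Q) ^ n) =
    1 / 2 ^ (2 * n + 1) * of_nat ((2 * n) choose n) + \<tau> (R + S) / 4 +
    1 / 2 ^ (2 * n) * (\<Sum>k = 1..n. of_nat ((2 * n) choose (n - k)) * \<tau> ((R * S) ^ k))"
proof -
  define W W' where "W = R * S" and "W' = S * R"
  have M: "R \<in> M" "S \<in> M" "P \<in> M" "Q \<in> M" "W \<in> M" "W' \<in> M"
    using RM SM by (simp_all add: P_def Q_def W_def W'_def)
  have RRx: "R * (R * x) = x" and SSx: "S * (S * x) = x" for x
    using RR SS by (simp_all flip: mult.assoc)
  have WW': "W * W' = 1" "W' * W = 1"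
    by (simp_all add: W_def W'_def mult.assoc RRx SSx RR SS)
  have RW: "W * R = R * W'" by (simp add: W_def W'_def mult.assoc)
  have RW': "W' * R = R * W" by (simp add: W_def W'_def mult.assoc RRx RR)
  have PP: "P * P = P"
    by (simp add: P_def RR algebra_simps flip: scaleR_add_left)
  \<comment> \<open>The product form makes powers of \<open>X\<close> binomial sums; the expanded
    form is symmetric in \<open>W\<close> and \<open>W'\<close>, which \<open>R\<close> exchanges,
    so \<open>X\<close> commutes with \<open>R\<close>.\<close>
  define X where "X = (1 / 4) *\<^sub>R ((1 + W) ^ 2 * W')"
  have X: "X = (1 / 4) *\<^sub>R (2 *\<^sub>R 1 + W + W')"
    by (simp add: X_def power2_eq_square distrib_left distrib_right mult.assoc WW')
      (simp add: scaleR_2)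
  have XM: "X \<in> M" using M by (simp add: X_def)
  have "X * R = R * X"
    by (simp add: X distrib_left distrib_right RW RW' add.commute add.left_commute)
  then have PX: "X * P = P * X" by (simp add: P_def distrib_left distrib_right)
  \<comment> \<open>\<open>1 + R\<close> absorbs a factor \<open>R\<close> on its right, so
    \<open>S\<close> may be replaced by \<open>W\<close> and \<open>S * R\<close> is already
    \<open>W'\<close>.\<close>
  have PQP: "P * Q * P = P * X"
  proof -
    have "8 *\<^sub>R (P * Q * P) = (1 + R) * (1 + S) * (1 + R)" by (simp add: P_def Q_def)
    also have "\<dots> = (1 + R) * (2 *\<^sub>R 1 + W + W')"
      by (simp add: distrib_left distrib_right W_def W'_def mult.assoc RR RRx SS SSx scaleR_2 algebra_simps)
    also have "\<dots> = 8 *\<^sub>R (P * X)" by (simp add: P_def X)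
    finally show ?thesis by (metis scaleR_cancel_left zero_neq_numeral)
  qed
  have pow: "(P * X) ^ n = P * X ^ n" if "n \<ge> 1" for n
  proof -
    have "P ^ n = P" if "n \<ge> 1" for n
      using that by (induction n rule: dec_induct) (simp_all add: PP)
    then show ?thesis using that by (simp add: power_mult_commute PX)
  qed
  have PQ_pow: "(P * Q) ^ n * P = (P * X) ^ n" if "n \<ge> 1" for n
    using that
  proof (induction n rule: dec_induct)
    case base
    show ?case by (simp add: PQP)
  next
    case (step n)
    have "(P * Q) ^ Suc n * P = P * Q * ((P * Q) ^ n * P)" by (simp add: mult.assoc)
    also have "\<dots> = P * Q * (P * X ^ n)" using step by (simp add: pow)
    also have "\<dots> = P * Q * P * X ^ n" by (simp add: mult.assoc)
    also have "\<dots> = (P * X) * (P * X ^ n)"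
      unfolding PQP by (metis PP PX mult.assoc)
    also have "\<dots> = (P * X) ^ Suc n" using step by (simp add: pow)
    finally show ?case .
  qed
  \<comment> \<open>Since \<open>n \<ge> 1\<close>, the power begins with \<open>P\<close>; a second
    copy of this projection is moved by the trace to the end, completing the last
    \<open>P * Q * P\<close>.\<close>
  have "(P * Q) ^ n = P * (Q * (P * Q) ^ (n - 1))"
    using n by (cases n) (simp_all add: mult.assoc)
  moreover have "P * (P * Q) ^ n = (P * Q) ^ n"
    using n PP by (cases n) (simp_all flip: mult.assoc)
  ultimately have "\<tau> ((P * Q) ^ n) = \<tau> ((P * Q) ^ n * P)"
    using M tau_commute [of P "(P * Q) ^ n"] by simp
  also have "\<dots> = \<tau> (P * X ^ n)" using n by (simp add: PQ_pow pow)
  also have "\<dots> = (\<tau> (X ^ n) + \<tau> (R * X ^ n)) / 2"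
    using M XM by (simp add: P_def distrib_right tau_linear)
  finally have main: "\<tau> ((P * Q) ^ n) = (\<tau> (X ^ n) + \<tau> (R * X ^ n)) / 2" .

  have X_pow: "X ^ n = (1 / 4 ^ n) *\<^sub>R (\<Sum>j\<le>2 * n. real ((2 * n) choose j) *\<^sub>R (W' ^ n * W ^ j))"
  proof -
    have c: "W' * (1 + W) ^ 2 = (1 + W) ^ 2 * W'"
      by (simp add: power2_eq_square distrib_left distrib_right mult.assoc WW' flip: mult.assoc [of W' W])
    have "(r *\<^sub>R x) ^ k = r ^ k *\<^sub>R x ^ k" for r k and x :: "'h cop"
      by (induction k) simp_all
    then have "X ^ n = (1 / 4) ^ n *\<^sub>R (W' * (1 + W) ^ 2) ^ n"
      unfolding X_def c by blast
    also have "(W' * (1 + W) ^ 2) ^ n = W' ^ n * (1 + W) ^ (2 * n)"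
      by (simp add: power_mult_commute [OF c] power_mult)
    finally show ?thesis
      by (simp add: binomial_power_one_plus sum_distrib_left power_one_over)
  qed
  have tau_W': "\<tau> (W' ^ k) = \<tau> (W ^ k)" for k
  proof -
    have "W' ^ k = R * (W ^ k * R)"
      using power_intertwine [OF RW, of k] by (simp add: RRx)
    then show ?thesis
      using M tau_commute [of R "W ^ k * R"] by (simp add: mult.assoc RR)
  qed
  have "\<tau> (X ^ n) = 1 / 4 ^ n * (\<Sum>j\<le>2 * n. of_nat ((2 * n) choose j) * \<tau> (W' ^ n * W ^ j))"
    unfolding X_pow using M by (simp add: tau_scaleR tau_sum sum_mem)
  \<comment> \<open>The term \<open>j\<close> carries \<open>W\<close> to the power
    \<open>j - n\<close>. Folding the sum at \<open>j = n\<close> pairs \<open>n - k\<close> with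
    \<open>n + k\<close>, which have equal binomials and, by \<open>tau_W'\<close>, equal
    traces.\<close>
  also have "(\<Sum>j\<le>2 * n. of_nat ((2 * n) choose j) * \<tau> (W' ^ n * W ^ j)) =
      of_nat ((2 * n) choose n) + 2 * (\<Sum>k = 1..n. of_nat ((2 * n) choose (n - k)) * \<tau> (W ^ k))"
  proof -
    let ?f = "\<lambda>j. of_nat ((2 * n) choose j) * \<tau> (W' ^ n * W ^ j)"
    have "{..2 * n} = (\<lambda>k. n - k) ` {1..n} \<union> ({n} \<union> (\<lambda>k. n + k) ` {1..n})"
    proof (intro set_eqI iffI)
      fix j assume j: "j \<in> {..2 * n}"
      consider "j < n" | "j = n" | "j > n" by linarith
      then show "j \<in> (\<lambda>k. n - k) ` {1..n} \<union> ({n} \<union> (\<lambda>k. n + k) ` {1..n})"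
      proof cases
        case 1
        then have "j = n - (n - j)" "n - j \<in> {1..n}" by auto
        then show ?thesis by blast
      next
        case 3
        then have "j = n + (j - n)" "j - n \<in> {1..n}" using j by auto
        then show ?thesis by blast
      qed simp
    qed auto
    then have "sum ?f {..2 * n} = sum ?f ((\<lambda>k. n - k) ` {1..n}) + (?f n + sum ?f ((\<lambda>k. n + k) ` {1..n}))"
      by (simp only:) (subst sum.union_disjoint; force)+
    also have "sum ?f ((\<lambda>k. n - k) ` {1..n}) = (\<Sum>k = 1..n. of_nat ((2 * n) choose (n - k)) * \<tau> (W ^ k))"
    proof (subst sum.reindex)
      show "inj_on (\<lambda>k. n - k) {1..n}" by (auto simp: inj_on_def)
      have "W' ^ n * W ^ (n - k) = W' ^ k" if "k \<in> {1..n}" for k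
        using inverse_power_mult_power(2) [OF WW'(2), of "n - k" k] that by simp
      then show "sum (?f \<circ> (\<lambda>k. n - k)) {1..n} = (\<Sum>k = 1..n. of_nat ((2 * n) choose (n - k)) * \<tau> (W ^ k))"
        by (intro sum.cong) (simp_all add: tau_W')
    qed
    also have "sum ?f ((\<lambda>k. n + k) ` {1..n}) = (\<Sum>k = 1..n. of_nat ((2 * n) choose (n - k)) * \<tau> (W ^ k))"
    proof (subst sum.reindex)
      have "(2 * n) choose (n + k) = (2 * n) choose (n - k)" if "k \<in> {1..n}" for k
        using that binomial_symmetric [of "n + k" "2 * n"] by simp
      then show "sum (?f \<circ> (\<lambda>k. n + k)) {1..n} = (\<Sum>k = 1..n. of_nat ((2 * n) choose (n - k)) * \<tau> (W ^ k))"
        by (intro sum.cong) (simp_all add: inverse_power_mult_power(1) [OF WW'(2)])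
    qed (simp add: inj_on_def)
    also have "?f n = of_nat ((2 * n) choose n)"
      using inverse_power_mult_power(1) [OF WW'(2), of n 0] by (simp add: tau_one)
    finally show ?thesis by simp
  qed
  finally have tau_X: "\<tau> (X ^ n) = 1 / 4 ^ n * (of_nat ((2 * n) choose n) +
      2 * (\<Sum>k = 1..n. of_nat ((2 * n) choose (n - k)) * \<tau> (W ^ k)))" .

  \<comment> \<open>Moving one \<open>W\<close> around the trace past \<open>R\<close> inverts it
    and lowers the exponent by two; the base cases are \<open>R\<close> and
    \<open>R * W = S\<close>.\<close>
  have tau_R: "\<tau> (R * W ^ k) = (if even k then \<tau> R else \<tau> S)" for k
  proof (induction k rule: nat_induct2)
    case (step k)
    have "R * W ^ (k + 2) = (R * W ^ Suc k) * W"
      by (simp add: power_Suc2 mult.assoc del: power_Suc)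
    then have "\<tau> (R * W ^ (k + 2)) = \<tau> (W * (R * W ^ Suc k))"
      using M tau_commute [of W "R * W ^ Suc k"] by (simp del: power_Suc)
    also have "W * (R * W ^ Suc k) = (W * R) * W * W ^ k" by (simp add: mult.assoc)
    also have "\<dots> = R * W ^ k" unfolding RW by (simp add: mult.assoc WW')
    finally show ?case using step by simp
  qed (simp_all add: W_def RRx)
  have R_shift: "\<tau> (R * (W' ^ n * W ^ j)) = \<tau> (R * W ^ (j + n))" for j
  proof -
    have "R * (W' ^ n * W ^ j) = W ^ n * (R * W ^ j)"
      using power_intertwine [OF RW, of n] by (simp flip: mult.assoc)
    then show ?thesis
      using M tau_commute [of "W ^ n" "R * W ^ j"] by (simp add: power_add mult.assoc)
  qed
  have "\<tau> (R * X ^ n) = 1 / 4 ^ n * (\<Sum>j\<le>2 * n. of_nat ((2 * n) choose j) * \<tau> (R * (W' ^ n * W ^ j)))"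
    unfolding X_pow using M by (simp add: sum_distrib_left tau_scaleR tau_sum sum_mem)
  also have "(\<Sum>j\<le>2 * n. of_nat ((2 * n) choose j) * \<tau> (R * (W' ^ n * W ^ j))) =
      4 ^ n / 2 * (\<tau> R + \<tau> S)"
  proof -
    \<comment> \<open>For \<open>n \<ge> 1\<close> the even and the odd binomial coefficients have
      the same sum, so the parity of \<open>n\<close>, which decides whether even \<open>j\<close>
      yield \<open>R\<close> or \<open>S\<close>, does not affect the result.\<close>
    have half: "(\<Sum>j\<le>2 * n. if even j then of_nat ((2 * n) choose j) else 0) = (4 ^ n / 2 :: complex)"
      "(\<Sum>j\<le>2 * n. if odd j then of_nat ((2 * n) choose j) else 0) = (4 ^ n / 2 :: complex)"
      using choose_even_sum [of "2 * n", where 'a = complex] choose_odd_sum [of "2 * n", where 'a = complex] n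
      by (simp_all add: power_mult mult.commute [of _ "2 :: complex"])
    have "(\<Sum>j\<le>2 * n. of_nat ((2 * n) choose j) * \<tau> (R * (W' ^ n * W ^ j))) =
      (\<Sum>j\<le>2 * n. (if even j then of_nat ((2 * n) choose j) else 0) * (if even n then \<tau> R else \<tau> S)
        + (if odd j then of_nat ((2 * n) choose j) else 0) * (if even n then \<tau> S else \<tau> R))"
      by (intro sum.cong) (simp_all add: R_shift tau_R)
    also have "\<dots> = 4 ^ n / 2 * (if even n then \<tau> R else \<tau> S) + 4 ^ n / 2 * (if even n then \<tau> S else \<tau> R)"
      unfolding sum.distrib sum_distrib_right [symmetric] half ..
    finally show ?thesis by (simp add: algebra_simps)
  qed
  finally have tau_RX: "\<tau> (R * X ^ n) = (\<tau> R + \<tau> S) / 2" by simp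
  have "(2 :: complex) ^ (2 * n + 1) = 2 * 4 ^ n" "(2 :: complex) ^ (2 * n) = 4 ^ n"
    by (simp_all add: power_mult)
  then show ?thesis
    unfolding main tau_X tau_RX tau_add [OF RM SM] W_def [symmetric]
    by (simp add: field_simps)
qed

end

section \<open>The moment formula for the free unitary Brownian motion\<close>

theorem proposition4p1:
  fixes M :: "'h::complex_hilbert cop set"
    and \<tau> :: "'h cop \<Rightarrow> complex"
    and P Q R S :: "'h cop"
    and U :: "real \<Rightarrow> 'h cop"
    and n :: nat and t :: real
  assumes "wstar_probability_space M \<tau>"
    and "P \<in> M" "orthogonal_projection P"
    and "Q \<in> M" "orthogonal_projection Q"
    and "R = 2 *\<^sub>R P - 1" "S = 2 *\<^sub>R Q - 1"
    and "free_unitary_brownian_motion M \<tau> U"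
    and "free_sets \<tau> (U ` {0..}) {P, Q}"
    and "n \<ge> 1" "t \<ge> 0"
  shows "\<tau> ((P * U t * Q * adj (U t)) ^ n) =
    1 / 2 ^ (2 * n + 1) * of_nat ((2 * n) choose n) + \<tau> (R + S) / 4 +
    1 / 2 ^ (2 * n) *
      (\<Sum>k = 1..n. of_nat ((2 * n) choose (n - k)) * \<tau> ((R * U t * S * adj (U t)) ^ k))"
proof -
  obtain B where B: "free_brownian_motion M \<tau> B" and sde: "solves_unitary_sde M \<tau> B U"
    using assms(8) by (auto simp: free_unitary_brownian_motion_def)
  interpret free_bm M \<tau> B
    using assms(1) B by unfold_locales
  define u where "u = U t"
  \<comment> \<open>Both unitarity relations matter: \<open>adj u * u = 1\<close> enters
    \<open>S' * S' = 1\<close> and \<open>\<tau> S' = \<tau> S\<close>, while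
    \<open>u * adj u = 1\<close> identifies the projection belonging to \<open>S'\<close> with
    \<open>u * Q * adj u\<close>.\<close>
  define S' where "S' = u * S * adj u"
  have uM: "u \<in> M"
    using sde assms(11) F_subset [of u t] by (simp add: solves_unitary_sde_def u_def)
  have uu: "u * adj u = 1"
    unfolding u_def by (rule sde_coisometry [OF sde assms(11)])
  have u'u: "adj u * u = 1" by (rule isometry_unitary [OF uM uu])
  have u'ux: "adj u * (u * x) = x" for x
    by (simp add: u'u flip: mult.assoc)
  have reflection: "(2 *\<^sub>R A - 1) * (2 *\<^sub>R A - 1) = 1" if "orthogonal_projection A" for A :: "'h cop"
    using that by (simp add: orthogonal_projection_def algebra_simps) (simp flip: scaleR_left_distrib)
  have M: "R \<in> M" "S \<in> M" "S' \<in> M"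
    using assms(2,4,6,7) uM by (simp_all add: S'_def)
  have "R * R = 1" "S * S = 1"
    using assms(3,5,6,7) reflection by simp_all
  moreover have "S' * S' = u * (S * S) * adj u" by (simp add: S'_def mult.assoc u'ux)
  ultimately have sq: "R * R = 1" "S' * S' = 1" by (simp_all add: uu)
  have P: "(1 / 2) *\<^sub>R (1 + R) = P" by (simp add: assms(6))
  have "1 + S' = 2 *\<^sub>R (u * Q * adj u)"
    by (simp add: S'_def assms(7) uu algebra_simps)
  then have Q: "(1 / 2) *\<^sub>R (1 + S') = u * Q * adj u" by simp
  have "\<tau> S' = \<tau> S"
    using M uM tau_commute [of "adj u" "u * S"] by (simp add: S'_def mult.assoc u'ux)
  then have "\<tau> (R + S') = \<tau> (R + S)" using M by (simp add: tau_add)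
  then show ?thesis
    using projection_pair_moments [OF M(1,3) sq assms(10)]
    unfolding P Q by (simp add: S'_def u_def mult.assoc)
qed

end
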